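(* For every integer $N\ge 3$ one has $C(N)\le A_N$. More precisely, $$C(3)=A_3=\tfrac14,\qquad C(4)=A_4=1,$$ while $$C(N)<A_N\qquad (N=9,10).$$ If $\Lambda_2(N):=3N-\sqrt{N^2+8N-8}$, then $$C(N)\le \Lambda_2(N)<\min\{A_N,2N\}\qquad\text{for every integer } N\ge 11.$$
   Context: Let $e_1,\dots,e_N$ be the standard basis of $\mathbb Z^N$ and $|n|$ the Euclidean norm. For finitely supported $u:\mathbb Z^N\to\mathbb C$ with $u(0)=0$ set $$\mathcal E_N[u]=\sum_{j=1}^N\sum_{n\in\mathbb Z^N}|u(n+e_j)-u(n)|^2,\qquad \mathcal D_N[u]=\sum_{n\in\mathbb Z^N\setminus\{0\}}\frac{|u(n)|^2}{|n|^2}.$$ The sharp scalar constant is $$C(N)=\inf\left\{\frac{\mathcal E_N[u]}{\mathcal D_N[u]}:\ u:\mathbb Z^N\to\mathbb C \text{ finitely supported},\ u(0)=0,\ u\ne 0\right\},$$ and $A_N=(N-2)^2/4$. *)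

theory Defs
  imports "HOL-Analysis.Analysis"
begin

text \<open>
  Since the dimension \<open>N\<close> varies inside the statement, a point of \<open>\<int>\<^sup>N\<close> is a function on
  \<^typ>\<open>nat\<close> with coordinates \<open>1, \<dots>, N\<close>, set to \<open>0\<close> at every other index.
\<close>

definition lattice :: "nat \<Rightarrow> (nat \<Rightarrow> int) set" where
  "lattice N = {n. \<forall>i. i \<notin> {1..N} \<longrightarrow> n i = 0}"

definition origin :: "nat \<Rightarrow> int" where
  "origin = (\<lambda>i. 0)"

definition basis_vec :: "nat \<Rightarrow> nat \<Rightarrow> int" where
  "basis_vec j = (\<lambda>i. if i = j then 1 else 0)"

definition translate :: "(nat \<Rightarrow> int) \<Rightarrow> (nat \<Rightarrow> int) \<Rightarrow> nat \<Rightarrow> int" where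
  "translate n m = (\<lambda>i. n i + m i)"

definition enorm :: "nat \<Rightarrow> (nat \<Rightarrow> int) \<Rightarrow> real" where
  "enorm N n = L2_set (\<lambda>i. real_of_int (n i)) {1..N}"

text \<open>
  Only the values of \<open>u\<close> on \<^term>\<open>lattice N\<close> enter the definitions below. For admissible \<open>u\<close> all
  the sums have finitely many nonzero terms.
\<close>

definition energy :: "nat \<Rightarrow> ((nat \<Rightarrow> int) \<Rightarrow> complex) \<Rightarrow> real" where
  "energy N u =
     (\<Sum>j=1..N. \<Sum>\<^sub>\<infinity>n\<in>lattice N. (cmod (u (translate n (basis_vec j)) - u n))\<^sup>2)"

definition hardy_sum :: "nat \<Rightarrow> ((nat \<Rightarrow> int) \<Rightarrow> complex) \<Rightarrow> real" where
  "hardy_sum N u = (\<Sum>\<^sub>\<infinity>n\<in>lattice N - {origin}. (cmod (u n))\<^sup>2 / (enorm N n)\<^sup>2)"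

definition admissible :: "nat \<Rightarrow> ((nat \<Rightarrow> int) \<Rightarrow> complex) \<Rightarrow> bool" where
  "admissible N u \<longleftrightarrow>
     finite {n \<in> lattice N. u n \<noteq> 0} \<and> u origin = 0 \<and> (\<exists>n\<in>lattice N. u n \<noteq> 0)"

definition sharp_const :: "nat \<Rightarrow> real" where
  "sharp_const N = Inf {energy N u / hardy_sum N u | u. admissible N u}"

definition hardy_const :: "nat \<Rightarrow> real" where
  "hardy_const N = (real N - 2)\<^sup>2 / 4"

definition Lambda2 :: "nat \<Rightarrow> real" where
  "Lambda2 N = 3 * real N - sqrt ((real N)\<^sup>2 + 8 * real N - 8)"

end

theory Submission
  imports Defs "HOL-Real_Asymp.Real_Asymp"
begin

text \<open>
  A bound from above for the sharp constant comes from a test function, a bound from below from a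
  Hardy inequality valid for all admissible functions. All test functions here are radial,
  \<open>u(n) = f(\<bar>n\<bar>\<^sup>2)\<close>, and for these both quadratic forms become finite sums over the numbers of
  representations of an integer as a sum of squares (\<open>energy_radial\<close>, \<open>hardy_sum_radial\<close>).

  The bound \<open>C(N) \<le> A\<^sub>N\<close> uses the continuum ground state \<open>\<bar>n\<bar>\<close> to the power \<open>- (N - 2) / 2\<close>, truncated at a large
  radius. Its squared gradient at \<open>n\<close> is asymptotically \<open>A\<^sub>N\<close> times \<open>\<bar>n\<bar>\<close> to the power \<open>- N\<close>, while the
  Hardy density is \<open>\<bar>n\<bar>\<close> to the power \<open>- N\<close> itself. The sum of the latter diverges logarithmically, so bounded
  errors from the origin and from the truncation disappear in the limit (\<open>sharp_const_le_hardy_const\<close>).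

  Equality for \<open>N = 3, 4\<close> needs \<open>\<E>[u] \<ge> A\<^sub>N \<D>[u]\<close>. By the arithmetic-geometric mean inequality, an edge
  from \<open>n\<close> to \<open>m\<close> satisfies \<open>\<bar>u(m) - u(n)\<bar>\<^sup>2 \<ge> (1 - c) \<bar>u(n)\<bar>\<^sup>2 + (1 - 1 / c) \<bar>u(m)\<bar>\<^sup>2\<close> for any \<open>c > 0\<close>. If each edge
  gets a ratio \<open>c\<close>, what remains is a pointwise inequality for the sum of the weights of the
  edges at \<open>n\<close>. Ratios of the ground state itself fail near the coordinate axes; a simple rational
  approximation of them, depending on a shift parameter, works. The weight of a direction is then a concave
  function of the square of the corresponding coordinate, which makes the axes the worst case and
  leaves a polynomial inequality in \<open>\<bar>n\<bar>\<^sup>2\<close> (\<open>weight_sum_ge\<close>, \<open>hardy_inequality\<close>).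

  For large \<open>N\<close> the quotient is already small on functions living near the origin. The two shells
  \<open>\<bar>n\<bar>\<^sup>2 = 1, 2\<close> give the bound \<open>\<Lambda>\<^sub>2(N)\<close> (\<open>sharp_const_le_Lambda2\<close>), three shells suffice for \<open>N = 10\<close>, and \<open>N = 9\<close>
  is a close case settled by an explicit profile on \<open>\<bar>n\<bar>\<^sup>2 \<le> 35\<close>.
\<close>

section \<open>Lattice points and radial functions\<close>

text \<open>
  Points supported on an arbitrary index set \<open>J\<close>: removing one coordinate direction \<open>j\<close> from
  \<open>{1..N}\<close> leaves a set that is no longer an initial segment, and the slicing arguments below
  need lattices over such sets.
\<close>

definition lat :: "nat set \<Rightarrow> (nat \<Rightarrow> int) set" where
  "lat J = {n. \<forall>i. i \<notin> J \<longrightarrow> n i = 0}"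

text \<open>
  A natural number, so that it can serve as argument of a radial profile and as index of a sum.
\<close>

definition sqn :: "nat set \<Rightarrow> (nat \<Rightarrow> int) \<Rightarrow> nat" where
  "sqn J n = (\<Sum>i\<in>J. (nat \<bar>n i\<bar>)\<^sup>2)"

text \<open>
  The number of points of squared length \<open>k\<close> in the \<open>N\<close>-dimensional lattice, that is, of
  representations of \<open>k\<close> as an ordered sum of \<open>N\<close> integer squares. The recursion splits off one
  coordinate.
\<close>

primrec num_rep :: "nat \<Rightarrow> nat \<Rightarrow> nat" where
  "num_rep 0 k = (if k = 0 then 1 else 0)"
| "num_rep (Suc N) k = (\<Sum>x\<in>{x::int. (nat \<bar>x\<bar>)\<^sup>2 \<le> k}. num_rep N (k - (nat \<bar>x\<bar>)\<^sup>2))"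

lemma lattice_eq_lat: "lattice N = lat {1..N}"
  by (simp add: lattice_def lat_def)

lemma enorm_sq: "(enorm N n)\<^sup>2 = real (sqn {1..N} n)"
  by (simp add: enorm_def L2_set_def sqn_def sum_nonneg)

lemma sqn_eq_0_iff:
  assumes "finite J" "n \<in> lat J"
  shows "sqn J n = 0 \<longleftrightarrow> n = origin"
  using assms by (auto simp: sqn_def lat_def origin_def fun_eq_iff)

lemma sqn_upd:
  assumes "j \<notin> J"
  shows "sqn J (n(j := x)) = sqn J n"
  unfolding sqn_def by (rule sum.cong) (use assms in auto)

lemma sqn_insert_upd:
  assumes "finite J" "j \<notin> J"
  shows "sqn (insert j J) (n(j := x)) = (nat \<bar>x\<bar>)\<^sup>2 + sqn J n"
  using sqn_upd[OF assms(2), of n x] assms by (simp add: sqn_def)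

lemma sqn_remove:
  assumes "finite J" "j \<in> J"
  shows "sqn J n = (nat \<bar>n j\<bar>)\<^sup>2 + sqn (J - {j}) n"
  using assms by (simp add: sqn_def sum.remove)

lemma real_sqn: "real (sqn J n) = (\<Sum>i\<in>J. (real_of_int (n i))\<^sup>2)"
  by (simp add: sqn_def)

lemma coord_sq_le_sqn:
  assumes "j \<in> {1..N}"
  shows "(real_of_int (n j))\<^sup>2 \<le> real (sqn {1..N} n)"
  unfolding real_sqn by (rule member_le_sum) (use assms in auto)

lemma translate_basis_vec: "translate n (basis_vec j) = n(j := n j + 1)"
  by (auto simp: translate_def basis_vec_def fun_eq_iff)

lemma sqn_translate:
  assumes "j \<in> {1..N}"
  shows "real (sqn {1..N} (translate n (basis_vec j))) = real (sqn {1..N} n) + 2 * of_int (n j) + 1"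
proof -
  have eq: "sqn {1..N} (n(j := n j + 1)) + (nat \<bar>n j\<bar>)\<^sup>2 = sqn {1..N} n + (nat \<bar>n j + 1\<bar>)\<^sup>2"
    using sqn_insert_upd[of "{1..N} - {j}" j n "n j + 1"] sqn_remove[OF _ assms, of n] assms
    by (simp add: insert_absorb)
  have "real (sqn {1..N} (n(j := n j + 1))) + (of_int (n j))\<^sup>2 = real (sqn {1..N} n) + (of_int (n j) + 1)\<^sup>2"
    using arg_cong[OF eq, of real] by simp
  then show ?thesis by (simp add: translate_basis_vec power2_eq_square algebra_simps)
qed

lemma sqn_basis_vec:
  assumes "j \<in> {1..N}"
  shows "sqn {1..N} (basis_vec j) = 1"
proof -
  have "sqn {1..N} (basis_vec j) = (\<Sum>i\<in>{1..N}. if i = j then 1 else 0)"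
    unfolding sqn_def by (rule sum.cong) (auto simp: basis_vec_def)
  then show ?thesis using assms by simp
qed

lemma bij_betw_lat_insert:
  assumes "j \<notin> J"
  shows "bij_betw (\<lambda>(x, n). n(j := x)) (UNIV \<times> lat J) (lat (insert j J))"
proof (rule bij_betw_byWitness[where f' = "\<lambda>n. (n j, n(j := 0))"])
  show "\<forall>a\<in>UNIV \<times> lat J. (\<lambda>n. (n j, n(j := 0))) (case a of (x, n) \<Rightarrow> n(j := x)) = a"
    using assms by (auto simp: lat_def fun_eq_iff)
  show "\<forall>a'\<in>lat (insert j J). (case (a' j, a'(j := 0)) of (x, n) \<Rightarrow> n(j := x)) = a'"
    by auto
  show "(\<lambda>(x, n). n(j := x)) ` (UNIV \<times> lat J) \<subseteq> lat (insert j J)"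
    by (auto simp: lat_def)
  show "(\<lambda>n. (n j, n(j := 0))) ` lat (insert j J) \<subseteq> UNIV \<times> lat J"
    by (auto simp: lat_def)
qed

lemma inj_lat_insert:
  assumes "j \<notin> J" "A \<subseteq> UNIV \<times> lat J"
  shows "inj_on (\<lambda>(x, n). n(j := x)) A"
  using bij_betw_lat_insert[OF assms(1)] assms(2) by (meson bij_betw_imp_inj_on inj_on_subset)

lemma finite_squares_le: "finite {x::int. (nat \<bar>x\<bar>)\<^sup>2 \<le> k}"
proof (rule finite_subset)
  show "{x::int. (nat \<bar>x\<bar>)\<^sup>2 \<le> k} \<subseteq> {- int k..int k}"
  proof
    fix x :: int assume "x \<in> {x::int. (nat \<bar>x\<bar>)\<^sup>2 \<le> k}"
    moreover have "nat \<bar>x\<bar> \<le> (nat \<bar>x\<bar>)\<^sup>2" unfolding power2_eq_square by (rule le_square)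
    ultimately have "nat \<bar>x\<bar> \<le> k" by simp
    then show "x \<in> {- int k..int k}" by auto
  qed
qed simp

lemma card_sphere:
  assumes "finite J"
  shows "finite {n \<in> lat J. sqn J n = k} \<and> card {n \<in> lat J. sqn J n = k} = num_rep (card J) k"
  using assms
proof (induction J arbitrary: k rule: finite_induct)
  case empty
  have "lat {} = {origin}" by (auto simp: lat_def origin_def)
  then have "{n \<in> lat {}. sqn {} n = k} = (if k = 0 then {origin} else {})"
    by (auto simp: sqn_def)
  then show ?case by simp
next
  case (insert j J)
  let ?X = "{x::int. (nat \<bar>x\<bar>)\<^sup>2 \<le> k}"
  let ?S = "SIGMA x:?X. {n \<in> lat J. sqn J n = k - (nat \<bar>x\<bar>)\<^sup>2}"
  have eq: "{n \<in> lat (insert j J). sqn (insert j J) n = k} = (\<lambda>(x, n). n(j := x)) ` ?S" (is "?L = ?R")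
  proof (intro equalityI subsetI)
    fix n assume n: "n \<in> ?L"
    then have "n \<in> (\<lambda>(x, n). n(j := x)) ` (UNIV \<times> lat J)"
      using bij_betw_imp_surj_on[OF bij_betw_lat_insert[OF insert(2)]] by blast
    then obtain x m where m: "m \<in> lat J" "n = m(j := x)"
      by (auto simp del: fun_upd_apply)
    with n have "(nat \<bar>x\<bar>)\<^sup>2 + sqn J m = k"
      by (simp add: sqn_insert_upd insert)
    with m have "(x, m) \<in> ?S" by auto
    with m(2) show "n \<in> ?R" by (metis (no_types, lifting) image_eqI old.prod.case)
  next
    fix n assume "n \<in> ?R"
    then obtain x m where m: "n = m(j := x)" "(x, m) \<in> ?S"
      by (metis (no_types, lifting) imageE old.prod.exhaust old.prod.case)
    have "m(j := x) \<in> lat (insert j J)" using m(2) by (auto simp: lat_def)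
    then show "n \<in> ?L"
      using sqn_insert_upd[OF insert(1,2), of m x] m by simp
  qed
  have inj: "inj_on (\<lambda>(x, n). n(j := x)) ?S"
    by (rule inj_lat_insert[OF insert(2)]) auto
  have "finite ?S" using insert(3) finite_squares_le by auto
  moreover have "card ?S = num_rep (Suc (card J)) k"
    using insert(3) finite_squares_le[of k] by simp
  ultimately show ?case unfolding eq using inj insert(1,2)
    by (simp add: card_image)
qed

lemma finite_ball_lat:
  assumes "finite J"
  shows "finite {n \<in> lat J. sqn J n \<le> k}"
proof -
  have "{n \<in> lat J. sqn J n \<le> k} = (\<Union>i\<le>k. {n \<in> lat J. sqn J n = i})" by auto
  then show ?thesis using card_sphere[OF assms] by simp
qed

lemma sum_ball_radial:
  fixes h :: "nat \<Rightarrow> real"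
  assumes "finite J"
  shows "(\<Sum>n | n \<in> lat J \<and> sqn J n \<le> R. h (sqn J n)) = (\<Sum>k\<le>R. real (num_rep (card J) k) * h k)"
proof -
  have "(\<Sum>n | n \<in> lat J \<and> sqn J n \<le> R. h (sqn J n))
      = (\<Sum>k\<le>R. \<Sum>n | n \<in> {n. n \<in> lat J \<and> sqn J n \<le> R} \<and> sqn J n = k. h (sqn J n))"
    by (rule sum.group[symmetric]) (auto simp: finite_ball_lat[OF assms])
  also have "\<dots> = (\<Sum>k\<le>R. real (num_rep (card J) k) * h k)"
  proof (rule sum.cong[OF refl])
    fix k assume "k \<in> {..R}"
    then have "{n. n \<in> {n. n \<in> lat J \<and> sqn J n \<le> R} \<and> sqn J n = k} = {n \<in> lat J. sqn J n = k}" by auto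
    then show "(\<Sum>n | n \<in> {n. n \<in> lat J \<and> sqn J n \<le> R} \<and> sqn J n = k. h (sqn J n))
        = real (num_rep (card J) k) * h k"
      using card_sphere[OF assms, of k] by simp
  qed
  finally show ?thesis .
qed

lemma infsum_finite_support:
  fixes g :: "'a \<Rightarrow> real"
  assumes "finite F" "F \<subseteq> A" "\<And>x. x \<in> A - F \<Longrightarrow> g x = 0"
  shows "infsum g A = sum g F"
proof -
  have "infsum g A = infsum g F"
    by (rule infsum_cong_neutral) (use assms in auto)
  then show ?thesis using assms(1) by simp
qed

text \<open>
  The summand depends on the coordinate \<open>n j\<close> and on the squared length of the rest only. Slicing
  along \<open>j\<close> groups the points by these two numbers; the bounds \<open>R\<close> and \<open>X\<close> make all sums finite.
\<close>

lemma infsum_line: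
  fixes G :: "nat \<Rightarrow> int \<Rightarrow> real"
  assumes J: "finite J" "j \<in> J"
    and G: "\<And>s x. G s x \<noteq> 0 \<Longrightarrow> s \<le> R \<and> x \<in> X" and X: "finite X"
  shows "(\<Sum>\<^sub>\<infinity>n\<in>lat J. G (sqn (J - {j}) n) (n j))
       = (\<Sum>s\<le>R. real (num_rep (card J - 1) s) * (\<Sum>x\<in>X. G s x))"
proof -
  define J' where "J' = J - {j}"
  have J': "finite J'" "j \<notin> J'" "insert j J' = J" "card J' = card J - 1"
    using J by (auto simp: J'_def)
  let ?B = "{n. n \<in> lat J' \<and> sqn J' n \<le> R}"
  have fB: "finite ?B" using finite_ball_lat[OF J'(1)] .
  have "(\<Sum>\<^sub>\<infinity>n\<in>lat J. G (sqn J' n) (n j))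
      = (\<Sum>\<^sub>\<infinity>(x, n)\<in>UNIV \<times> lat J'. G (sqn J' n) x)"
    using infsum_reindex_bij_betw[OF bij_betw_lat_insert[OF J'(2)], of "\<lambda>n. G (sqn J' n) (n j)"]
    by (simp add: J'(3) case_prod_beta' sqn_upd[OF J'(2)])
  also have "\<dots> = (\<Sum>(x, n)\<in>X \<times> ?B. G (sqn J' n) x)"
    by (rule infsum_finite_support) (use X fB G in auto)
  also have "\<dots> = (\<Sum>x\<in>X. \<Sum>n\<in>?B. G (sqn J' n) x)"
    by (simp add: sum.cartesian_product)
  also have "\<dots> = (\<Sum>x\<in>X. \<Sum>s\<le>R. real (num_rep (card J') s) * G s x)"
    by (intro sum.cong refl sum_ball_radial[OF J'(1)])
  also have "\<dots> = (\<Sum>s\<le>R. real (num_rep (card J - 1) s) * (\<Sum>x\<in>X. G s x))"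
    by (subst sum.swap) (simp add: sum_distrib_left J'(4))
  finally show ?thesis by (simp add: J'_def)
qed

definition radial :: "nat \<Rightarrow> (nat \<Rightarrow> real) \<Rightarrow> (nat \<Rightarrow> int) \<Rightarrow> complex" where
  "radial N f n = complex_of_real (f (sqn {1..N} n))"

text \<open>
  By symmetry every direction contributes equally, so one direction suffices. An edge in that
  direction joins \<open>(x, m)\<close> to \<open>(x + 1, m)\<close>, with squared lengths \<open>s + x\<^sup>2\<close> and \<open>s + (x + 1)\<^sup>2\<close>, where \<open>s\<close>
  is the squared length of \<open>m\<close>; the reflection \<open>x \<mapsto> - 1 - x\<close> accounts for the factor 2 and leaves
  only \<open>x \<ge> 0\<close>. The condition \<open>R < K\<^sup>2\<close> says that beyond \<open>x = K\<close> both ends lie outside the support.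
\<close>

lemma energy_radial:
  fixes f :: "nat \<Rightarrow> real"
  assumes f: "\<And>k. k > R \<Longrightarrow> f k = 0" and K: "R < K\<^sup>2"
  shows "energy N (radial N f) = real N * (\<Sum>s\<le>R. real (num_rep (N - 1) s) *
           (2 * (\<Sum>x<K. (f (s + (Suc x)\<^sup>2) - f (s + x\<^sup>2))\<^sup>2)))"
proof -
  define G where "G s x = (f (s + (nat \<bar>x + 1\<bar>)\<^sup>2) - f (s + (nat \<bar>x\<bar>)\<^sup>2))\<^sup>2" for s and x :: int
  let ?X = "{- int K..<int K}"
  have G: "s \<le> R \<and> x \<in> ?X" if "G s x \<noteq> 0" for s x
  proof -
    have "f (s + (nat \<bar>x + 1\<bar>)\<^sup>2) \<noteq> 0 \<or> f (s + (nat \<bar>x\<bar>)\<^sup>2) \<noteq> 0"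
      using that by (auto simp: G_def)
    then have *: "s + (nat \<bar>x + 1\<bar>)\<^sup>2 \<le> R \<or> s + (nat \<bar>x\<bar>)\<^sup>2 \<le> R"
      using f not_le_imp_less by blast
    then have "(nat \<bar>x + 1\<bar>)\<^sup>2 < K\<^sup>2 \<or> (nat \<bar>x\<bar>)\<^sup>2 < K\<^sup>2" using K by linarith
    then have "nat \<bar>x + 1\<bar> < K \<or> nat \<bar>x\<bar> < K" using power_less_imp_less_base by blast
    then have "x \<in> ?X" by auto
    with * show ?thesis by auto
  qed
  have neg: "(\<Sum>x\<in>?X. G s x) = 2 * (\<Sum>x<K. (f (s + (Suc x)\<^sup>2) - f (s + x\<^sup>2))\<^sup>2)" for s
  proof -
    have "(\<Sum>x\<in>?X. G s x) = (\<Sum>x\<in>{- int K..<0}. G s x) + (\<Sum>x\<in>{0..<int K}. G s x)"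
      by (subst sum.union_disjoint[symmetric]) (auto intro!: sum.cong)
    moreover have "(\<Sum>x\<in>{- int K..<0}. G s x) = (\<Sum>x\<in>{0..<int K}. G s x)"
      by (rule sum.reindex_bij_witness[where i = "\<lambda>x. - 1 - x" and j = "\<lambda>x. - 1 - x"])
        (auto simp: G_def power2_commute abs_minus_commute)
    moreover have "(\<Sum>x\<in>{0..<int K}. G s x) = (\<Sum>x<K. G s (int x))"
      by (rule sum.reindex_bij_witness[where i = int and j = nat]) auto
    moreover have "G s (int x) = (f (s + (Suc x)\<^sup>2) - f (s + x\<^sup>2))\<^sup>2" for x
    proof -
      have "nat \<bar>int x + 1\<bar> = Suc x" by simp
      then show ?thesis unfolding G_def by simp
    qed
    ultimately show ?thesis by simp
  qed
  have "(\<Sum>\<^sub>\<infinity>n\<in>lattice N. (cmod (radial N f (translate n (basis_vec j)) - radial N f n))\<^sup>2)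
      = (\<Sum>s\<le>R. real (num_rep (N - 1) s) * (\<Sum>x\<in>?X. G s x))" if j: "j \<in> {1..N}" for j
  proof -
    have "(cmod (radial N f (translate n (basis_vec j)) - radial N f n))\<^sup>2 = G (sqn ({1..N} - {j}) n) (n j)" for n
    proof -
      have "sqn {1..N} (n(j := n j + 1)) = sqn ({1..N} - {j}) n + (nat \<bar>n j + 1\<bar>)\<^sup>2"
        using sqn_insert_upd[of "{1..N} - {j}" j n "n j + 1"] j by (simp add: insert_absorb)
      moreover have "sqn {1..N} n = sqn ({1..N} - {j}) n + (nat \<bar>n j\<bar>)\<^sup>2"
        using sqn_remove[OF _ j, of n] by simp
      ultimately show ?thesis
        by (simp add: radial_def G_def translate_basis_vec flip: of_real_diff)
    qed
    then show ?thesis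
      using infsum_line[of "{1..N}" j G R ?X] j G by (simp add: lattice_eq_lat)
  qed
  then show ?thesis by (simp add: energy_def neg)
qed

lemma hardy_sum_radial:
  fixes f :: "nat \<Rightarrow> real"
  assumes f: "\<And>k. k > R \<Longrightarrow> f k = 0" and "f 0 = 0"
  shows "hardy_sum N (radial N f) = (\<Sum>k\<le>R. real (num_rep N k) * ((f k)\<^sup>2 / real k))"
proof -
  let ?B = "{n. n \<in> lat {1..N} \<and> sqn {1..N} n \<le> R}"
  have "hardy_sum N (radial N f) = (\<Sum>\<^sub>\<infinity>n\<in>lat {1..N} - {origin}. (f (sqn {1..N} n))\<^sup>2 / real (sqn {1..N} n))"
    by (simp add: hardy_sum_def lattice_eq_lat radial_def enorm_sq)
  also have "\<dots> = (\<Sum>n\<in>?B - {origin}. (f (sqn {1..N} n))\<^sup>2 / real (sqn {1..N} n))"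
    by (rule infsum_finite_support) (use f finite_ball_lat[of "{1..N}" R] in auto)
  also have "\<dots> = (\<Sum>n\<in>?B. (f (sqn {1..N} n))\<^sup>2 / real (sqn {1..N} n))"
    by (rule sum.mono_neutral_left) (use finite_ball_lat[of "{1..N}" R] in \<open>auto simp: sqn_def origin_def\<close>)
  also have "\<dots> = (\<Sum>k\<le>R. real (num_rep N k) * ((f k)\<^sup>2 / real k))"
    using sum_ball_radial[of "{1..N}" "\<lambda>k. (f k)\<^sup>2 / real k" R] by simp
  finally show ?thesis .
qed

lemma admissible_radial:
  assumes f: "\<And>k. k > R \<Longrightarrow> f k = 0" and "f 0 = 0" and f1: "f 1 \<noteq> 0" and N: "N \<ge> 1"
  shows "admissible N (radial N f)"
  unfolding admissible_def
proof (intro conjI)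
  have "{n \<in> lattice N. radial N f n \<noteq> 0} \<subseteq> {n \<in> lat {1..N}. sqn {1..N} n \<le> R}"
    using f by (auto simp: lattice_eq_lat radial_def intro!: leI)
  then show "finite {n \<in> lattice N. radial N f n \<noteq> 0}"
    using finite_ball_lat finite_subset by blast
  show "radial N f origin = 0" using \<open>f 0 = 0\<close> by (simp add: radial_def sqn_def origin_def)
  have "sqn {1..N} (basis_vec 1) = 1" using N by (intro sqn_basis_vec) simp
  then have "radial N f (basis_vec 1) \<noteq> 0" using f1 by (simp add: radial_def)
  moreover have "basis_vec 1 \<in> lattice N" using N by (auto simp: lattice_def basis_vec_def)
  ultimately show "\<exists>n\<in>lattice N. radial N f n \<noteq> 0" by blast
qed

lemma energy_nonneg: "energy N u \<ge> 0"
  unfolding energy_def by (intro sum_nonneg infsum_nonneg) auto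

lemma hardy_sum_nonneg: "hardy_sum N u \<ge> 0"
  unfolding hardy_sum_def by (intro infsum_nonneg) auto

lemma hardy_sum_pos:
  assumes "admissible N u"
  shows "hardy_sum N u > 0"
proof -
  let ?F = "{n \<in> lattice N. u n \<noteq> 0}"
  let ?w = "\<lambda>n. (cmod (u n))\<^sup>2 / (enorm N n)\<^sup>2"
  have F: "finite ?F" "?F \<noteq> {}" "?F \<subseteq> lattice N - {origin}"
    using assms by (auto simp: admissible_def)
  have "hardy_sum N u = sum ?w ?F"
    unfolding hardy_sum_def by (rule infsum_finite_support) (use F in auto)
  moreover have "?w n > 0" if "n \<in> ?F" for n
  proof -
    have "sqn {1..N} n \<noteq> 0"
      using sqn_eq_0_iff[of "{1..N}" n] that F(3) by (auto simp: lattice_eq_lat)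
    then show ?thesis using that by (simp add: enorm_sq)
  qed
  ultimately show ?thesis using sum_pos[OF F(1,2), of ?w] by presburger
qed

lemma sharp_const_mult_le:
  assumes "admissible N u"
  shows "sharp_const N * hardy_sum N u \<le> energy N u"
proof -
  have "sharp_const N \<le> energy N u / hardy_sum N u"
    unfolding sharp_const_def
  proof (rule cInf_lower)
    show "bdd_below {energy N u / hardy_sum N u |u. admissible N u}"
      by (rule bdd_belowI[of _ 0]) (auto simp: energy_nonneg hardy_sum_nonneg)
  qed (use assms in auto)
  then show ?thesis using hardy_sum_pos[OF assms] by (simp add: field_simps)
qed

section \<open>The sharp Hardy inequality in dimensions 3 and 4\<close>

lemma summable_on_finite_support:
  fixes g :: "'a \<Rightarrow> real"
  assumes "finite F" "\<And>x. x \<in> A - F \<Longrightarrow> g x = 0"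
  shows "g summable_on A"
proof -
  have "g summable_on A \<longleftrightarrow> g summable_on (A \<inter> F)"
    by (rule summable_on_cong_neutral) (use assms in auto)
  then show ?thesis using assms(1) by simp
qed

lemma bij_betw_translate:
  assumes "j \<in> {1..N}"
  shows "bij_betw (\<lambda>n. translate n (basis_vec j)) (lattice N) (lattice N)"
  by (rule bij_betw_byWitness[where f' = "\<lambda>n. n(j := n j - 1)"])
    (use assms in \<open>auto simp: lattice_def translate_basis_vec fun_eq_iff\<close>)

text \<open>
  Summing edge inequalities over all edges: the weight at the upper end of an edge is moved to the
  point itself by translating the lattice, so that every point collects \<open>a j\<close> from the edge leaving
  it and \<open>- b j\<close> from the edge entering it in each direction.
\<close>

lemma energy_ge_weighted_sum:
  fixes a b :: "nat \<Rightarrow> (nat \<Rightarrow> int) \<Rightarrow> real"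
  assumes fin: "finite {n \<in> lattice N. u n \<noteq> 0}"
    and edge: "\<And>j n. j \<in> {1..N} \<Longrightarrow> n \<in> lattice N \<Longrightarrow>
      a j n * (cmod (u n))\<^sup>2 - b j (translate n (basis_vec j)) * (cmod (u (translate n (basis_vec j))))\<^sup>2
        \<le> (cmod (u (translate n (basis_vec j)) - u n))\<^sup>2"
  shows "(\<Sum>n | n \<in> lattice N \<and> u n \<noteq> 0. (\<Sum>j=1..N. a j n - b j n) * (cmod (u n))\<^sup>2) \<le> energy N u"
proof -
  define F where "F = {n. n \<in> lattice N \<and> u n \<noteq> 0}"
  have F: "finite F" "F \<subseteq> lattice N" using fin by (auto simp: F_def)
  have out: "u n = 0" if "n \<in> lattice N - F" for n using that by (auto simp: F_def)
  have "(\<Sum>n\<in>F. (a j n - b j n) * (cmod (u n))\<^sup>2)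
      \<le> (\<Sum>\<^sub>\<infinity>n\<in>lattice N. (cmod (u (translate n (basis_vec j)) - u n))\<^sup>2)" if j: "j \<in> {1..N}" for j
  proof -
    let ?t = "\<lambda>n. translate n (basis_vec j)"
    let ?f = "\<lambda>n. a j n * (cmod (u n))\<^sup>2" and ?g = "\<lambda>n. b j n * (cmod (u n))\<^sup>2"
    note bij = bij_betw_translate[OF j]
    have sf: "?f summable_on lattice N" and sg: "?g summable_on lattice N"
      by (rule summable_on_finite_support[OF F(1)], simp add: out)+
    then have sgt: "(\<lambda>n. ?g (?t n)) summable_on lattice N"
      using summable_on_reindex_bij_betw[OF bij, of ?g] by simp
    have "?t ` (lattice N) = lattice N" using bij bij_betw_imp_surj_on by blast
    then have tl: "?t n \<in> lattice N" if "n \<in> lattice N" for n using that by blast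
    have "finite {n \<in> lattice N. ?t n \<in> F}"
    proof (rule inj_on_finite[of ?t])
      show "inj_on ?t {n \<in> lattice N. ?t n \<in> F}"
        using bij by (auto simp: bij_betw_def inj_on_def)
    qed (use F in auto)
    then have finE: "finite (F \<union> {n \<in> lattice N. ?t n \<in> F})" using F by blast
    have sE: "(\<lambda>n. (cmod (u (?t n) - u n))\<^sup>2) summable_on lattice N"
      by (rule summable_on_finite_support[OF finE]) (use out tl in auto)
    have sd: "(\<lambda>n. ?f n - ?g (?t n)) summable_on lattice N"
      using summable_on_add[OF sf summable_on_uminus[THEN iffD2, OF sgt]] by simp
    have "(\<Sum>n\<in>F. (a j n - b j n) * (cmod (u n))\<^sup>2) = infsum ?f (lattice N) - infsum ?g (lattice N)"
      using infsum_finite_support[OF F, of ?f] infsum_finite_support[OF F, of ?g] out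
      by (simp add: sum_subtractf algebra_simps)
    also have "infsum ?g (lattice N) = (\<Sum>\<^sub>\<infinity>n\<in>lattice N. ?g (?t n))"
      using infsum_reindex_bij_betw[OF bij, of ?g] by simp
    also have "infsum ?f (lattice N) - \<dots> = (\<Sum>\<^sub>\<infinity>n\<in>lattice N. ?f n - ?g (?t n))"
      using infsum_add[OF sf summable_on_uminus[THEN iffD2, OF sgt]] infsum_uminus[of "\<lambda>n. ?g (?t n)" "lattice N"] by simp
    also have "\<dots> \<le> (\<Sum>\<^sub>\<infinity>n\<in>lattice N. (cmod (u (?t n) - u n))\<^sup>2)"
      by (rule infsum_mono[OF sd sE]) (use edge[OF j] in auto)
    finally show ?thesis .
  qed
  then have "(\<Sum>j=1..N. \<Sum>n\<in>F. (a j n - b j n) * (cmod (u n))\<^sup>2) \<le> energy N u"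
    unfolding energy_def by (rule sum_mono)
  also have "(\<Sum>j=1..N. \<Sum>n\<in>F. (a j n - b j n) * (cmod (u n))\<^sup>2)
      = (\<Sum>n\<in>F. (\<Sum>j=1..N. a j n - b j n) * (cmod (u n))\<^sup>2)"
    by (subst sum.swap) (simp add: sum_distrib_right)
  finally show ?thesis by (simp add: F_def)
qed

text \<open>
  For \<open>c > 0\<close> the inequality \<open>\<bar>x - y\<bar>\<^sup>2 \<ge> (1 - c) \<bar>y\<bar>\<^sup>2 + (1 - 1 / c) \<bar>x\<bar>\<^sup>2\<close> is the arithmetic-geometric mean
  inequality for the cross term. Here \<open>c = Q / P\<close>.
\<close>

lemma edge_inequality:
  fixes x y :: complex and P Q :: real
  assumes "P > 0" "Q > 0"
  shows "(P - Q) / P * (cmod y)\<^sup>2 - (P - Q) / Q * (cmod x)\<^sup>2 \<le> (cmod (x - y))\<^sup>2"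
proof -
  define s t where "s = cmod x" and "t = cmod y"
  have "(s - t)\<^sup>2 - ((P - Q) / P * t\<^sup>2 - (P - Q) / Q * s\<^sup>2) = (Q * t - P * s)\<^sup>2 / (P * Q)"
    using assms by (simp add: field_simps power2_eq_square)
  also have "\<dots> \<ge> 0" using assms by simp
  finally have "(P - Q) / P * t\<^sup>2 - (P - Q) / Q * s\<^sup>2 \<le> (s - t)\<^sup>2" by linarith
  also have "(s - t)\<^sup>2 \<le> (cmod (x - y))\<^sup>2"
    using norm_triangle_ineq3[of x y] by (simp add: s_def t_def abs_le_square_iff[symmetric])
  finally show ?thesis by (simp add: s_def t_def)
qed

text \<open>
  The positive function \<open>\<bar>x\<bar>\<close> to the power \<open>- (N - 2) / 2\<close> is the ground state of the Hardy operator in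
  the continuum. Along an edge with midpoint \<open>y\<close> in direction \<open>j\<close> its ratio is, to leading
  order, \<open>Q / P\<close> with \<open>(P - Q) / (P + Q) = (N - 2) y\<^sub>j / (4 \<bar>y\<bar>\<^sup>2 + b)\<close>. The edge weights below use this rational
  ratio instead of the power itself. For \<open>b = 9 (N - 2) / 2 - 1\<close> one can take for \<open>P\<close> and \<open>Q\<close> the numbers \<open>edge_denom N n + (N + 2) n\<^sub>j\<close> at the lower end and
  \<open>edge_denom N m - (N + 2) m\<^sub>j\<close> at the upper end \<open>m\<close>. On a coordinate axis the weight at
  a point exceeds \<open>hardy_const N / \<bar>n\<bar>\<^sup>2\<close> at the next order exactly when the constant added to \<open>4 \<bar>n\<bar>\<^sup>2\<close> is larger than
  \<open>N (N + 2)\<^sup>2 / 16\<close>, that is \<open>75 / 16\<close> for \<open>N = 3\<close> and \<open>9\<close> for \<open>N = 4\<close>; the values \<open>5\<close> and \<open>10\<close> of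
  \<open>5 (N - 2)\<close> are just above.
\<close>

definition edge_denom :: "nat \<Rightarrow> (nat \<Rightarrow> int) \<Rightarrow> real" where
  "edge_denom N n = 4 * real (sqn {1..N} n) + 5 * (real N - 2)"

text \<open>
  On the edges that touch the origin, where \<open>u\<close> vanishes, the whole of \<open>\<bar>u\<bar>\<^sup>2\<close> at the other end is
  available, hence the exceptional values \<open>1\<close> here and \<open>- 1\<close> in the next definition.
\<close>

definition tail_weight :: "nat \<Rightarrow> nat \<Rightarrow> (nat \<Rightarrow> int) \<Rightarrow> real" where
  "tail_weight N j n = (if translate n (basis_vec j) = origin then 1
     else (real N - 2) * (2 * of_int (n j) + 1) / (edge_denom N n + (real N + 2) * of_int (n j)))"

definition head_weight :: "nat \<Rightarrow> nat \<Rightarrow> (nat \<Rightarrow> int) \<Rightarrow> real" where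
  "head_weight N j n = (if n = basis_vec j then - 1
     else (real N - 2) * (2 * of_int (n j) - 1) / (edge_denom N n - (real N + 2) * of_int (n j)))"

lemma edge_denom_dominates:
  assumes N: "N \<in> {3, 4}" and j: "j \<in> {1..N}"
  shows "edge_denom N n + (real N + 2) * of_int (n j) > 0" "edge_denom N n - (real N + 2) * of_int (n j) > 0"
proof -
  define x where "x = real_of_int (n j)"
  have "4 * x\<^sup>2 + 5 * (real N - 2) \<le> edge_denom N n"
    using coord_sq_le_sqn[OF j, of n] by (simp add: edge_denom_def x_def)
  moreover have "4 * x\<^sup>2 + 5 * (real N - 2) + (real N + 2) * y > 0" if "y\<^sup>2 = x\<^sup>2" for y
  proof -
    have "4 * y\<^sup>2 + 5 * (real N - 2) + (real N + 2) * y
        = (2 * y + (real N + 2) / 4)\<^sup>2 + (5 * (real N - 2) - ((real N + 2) / 4)\<^sup>2)"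
      by (simp add: power2_eq_square algebra_simps)
    moreover have "5 * (real N - 2) - ((real N + 2) / 4)\<^sup>2 > 0"
      using N by (auto simp: power2_eq_square)
    ultimately show ?thesis using that by (metis add_nonneg_pos zero_le_power2)
  qed
  from this[of x] this[of "- x"] 
  have "4 * x\<^sup>2 + 5 * (real N - 2) + (real N + 2) * x > 0"
    "4 * x\<^sup>2 + 5 * (real N - 2) - (real N + 2) * x > 0" by auto
  ultimately show "edge_denom N n + (real N + 2) * of_int (n j) > 0" "edge_denom N n - (real N + 2) * of_int (n j) > 0"
    unfolding x_def by linarith+
qed

lemma edge_denom_translate:
  assumes "j \<in> {1..N}"
  shows "edge_denom N (translate n (basis_vec j)) = edge_denom N n + 8 * of_int (n j) + 4"
  using sqn_translate[OF assms, of n] by (simp add: edge_denom_def)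

lemma weighted_edge_inequality:
  assumes N: "N \<in> {3, 4}" and j: "j \<in> {1..N}" and u0: "u origin = 0"
  shows "tail_weight N j n * (cmod (u n))\<^sup>2
      - head_weight N j (translate n (basis_vec j)) * (cmod (u (translate n (basis_vec j))))\<^sup>2
    \<le> (cmod (u (translate n (basis_vec j)) - u n))\<^sup>2"
proof -
  define m where "m = translate n (basis_vec j)"
  have m_iff: "m = basis_vec j \<longleftrightarrow> n = origin"
    by (auto simp: m_def translate_def basis_vec_def origin_def fun_eq_iff)
  \<comment> \<open>In the first two cases one end of the edge is the origin.\<close>
  consider "m = origin" | "m \<noteq> origin" "n = origin" | "m \<noteq> origin" "n \<noteq> origin" by blast
  then show ?thesis
  proof cases
    case 1
    then show ?thesis using u0 by (simp add: tail_weight_def flip: m_def)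
  next
    case 2
    then have "m = basis_vec j" using m_iff by blast
    then have "head_weight N j m = - 1" by (simp add: head_weight_def)
    then show ?thesis using u0 2 unfolding m_def[symmetric] by simp
  next
    case 3
    define x where "x = real_of_int (n j)"
    define P where "P = edge_denom N n + (real N + 2) * x"
    define Q where "Q = edge_denom N m - (real N + 2) * (x + 1)"
    have mj: "real_of_int (m j) = x + 1" by (simp add: m_def x_def translate_basis_vec)
    have "P > 0" using edge_denom_dominates(1)[OF N j, of n] by (simp add: P_def x_def)
    moreover have "Q > 0" using edge_denom_dominates(2)[OF N j, of m] by (simp add: Q_def mj)
    moreover have PQ: "P - Q = (real N - 2) * (2 * x + 1)"
      using edge_denom_translate[OF j, of n] by (simp add: P_def Q_def m_def x_def algebra_simps)
    have "tail_weight N j n = (P - Q) / P"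
      unfolding PQ using 3 by (simp add: tail_weight_def P_def x_def flip: m_def)
    moreover have "head_weight N j m = (P - Q) / Q"
      unfolding PQ using 3 m_iff by (simp add: head_weight_def Q_def mj)
    ultimately show ?thesis using edge_inequality[of P Q "u n" "u m"] by (simp flip: m_def)
  qed
qed

text \<open>
  At a unit vector the edge to the origin alone contributes \<open>1\<close>, which is at least \<open>hardy_const N\<close>.
  Further out, direction \<open>j\<close> contributes a concave function of \<open>n\<^sub>j\<^sup>2\<close>. The squares add up to \<open>R = \<bar>n\<bar>\<^sup>2\<close>, so
  the sum is smallest on a coordinate axis; replacing each term by its chord over \<open>[0, R]\<close> reduces
  the claim to a rational inequality in \<open>R\<close> alone.
\<close>

lemma weight_sum_ge:
  assumes N: "N \<in> {3, 4}" and n: "n \<in> lattice N" "n \<noteq> origin"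
  shows "hardy_const N / real (sqn {1..N} n) \<le> (\<Sum>j=1..N. tail_weight N j n - head_weight N j n)"
proof -
  define R where "R = real (sqn {1..N} n)"
  have "sqn {1..N} n \<noteq> 0" using sqn_eq_0_iff[of "{1..N}" n] n by (simp add: lattice_eq_lat)
  then consider "sqn {1..N} n = 1" | "sqn {1..N} n \<ge> 2" by linarith
  then show ?thesis
  proof cases
    case 1
    obtain i where i: "n i \<noteq> 0" using n(2) by (auto simp: origin_def)
    then have iN: "i \<in> {1..N}" using n(1) by (auto simp: lattice_def)
    have "nat \<bar>n i\<bar> > 0" using i by simp
    then have "(nat \<bar>n i\<bar>)\<^sup>2 \<ge> 1" by (metis One_nat_def Suc_leI zero_less_power)
    moreover have "(nat \<bar>n i\<bar>)\<^sup>2 + sqn ({1..N} - {i}) n = 1"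
      using sqn_remove[OF _ iN, of n] 1 by simp
    ultimately have ni: "(nat \<bar>n i\<bar>)\<^sup>2 = 1" and rest: "sqn ({1..N} - {i}) n = 0"
      by linarith+
    have zero: "n l = 0" if "l \<noteq> i" for l
      using rest that n(1) by (cases "l \<in> {1..N}") (auto simp: sqn_def lattice_def)
    have pm: "n i = 1 \<or> n i = - 1" using ni by (auto simp: power2_eq_square nat_eq_iff abs_if split: if_splits)
    have W: "edge_denom N n > 0" using N by (auto simp: edge_denom_def)
    have B: "real N - 2 > 0" using N by auto
    have other: "tail_weight N j n - head_weight N j n \<ge> 0" if "j \<noteq> i" for j
    proof -
      have "translate n (basis_vec j) i \<noteq> origin i" "n i \<noteq> basis_vec j i"
        using i that by (simp_all add: translate_def origin_def basis_vec_def)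
      then have "translate n (basis_vec j) \<noteq> origin" "n \<noteq> basis_vec j" by metis+
      then show ?thesis using zero[OF that] W B by (simp add: tail_weight_def head_weight_def divide_right_mono)
    qed
    have main: "tail_weight N i n - head_weight N i n \<ge> 1"
      using pm
    proof
      assume p: "n i = 1"
      have "n = basis_vec i" using zero p by (auto simp: basis_vec_def fun_eq_iff)
      moreover have "translate n (basis_vec i) \<noteq> origin"
        using p by (auto simp: translate_basis_vec origin_def fun_eq_iff)
      ultimately show ?thesis using p edge_denom_dominates(1)[OF N iN, of n] B
        by (simp add: tail_weight_def head_weight_def)
    next
      assume p: "n i = - 1"
      have "translate n (basis_vec i) = origin"
        using zero p by (auto simp: translate_basis_vec origin_def fun_eq_iff)
      moreover have "n \<noteq> basis_vec i"
        using p by (auto simp: basis_vec_def fun_eq_iff)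
      ultimately show ?thesis using p edge_denom_dominates(2)[OF N iN, of n] B
        by (simp add: tail_weight_def head_weight_def divide_nonpos_pos)
    qed
    have "hardy_const N / real (sqn {1..N} n) \<le> 1"
      using N 1 by (auto simp: hardy_const_def power2_eq_square)
    also have "\<dots> \<le> tail_weight N i n - head_weight N i n" by (rule main)
    also have "\<dots> \<le> (\<Sum>j=1..N. tail_weight N j n - head_weight N j n)"
      by (rule member_le_sum) (use iN other in auto)
    finally show ?thesis .
  next
    case 2
    then have R: "R \<ge> 2" by (simp add: R_def)
    define M k B where "M = edge_denom N n" and "k = real N + 2" and "B = real N - 2"
    have M: "M = 4 * R + 5 * B" by (simp add: M_def edge_denom_def R_def B_def)
    have B: "B > 0" "k > 0" using N by (auto simp: B_def k_def)
    have Mpos: "M > 0" using M R B by simp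
    have kM: "4 * k - 2 * k\<^sup>2 / M \<ge> 0"
    proof -
      have "k \<le> 2 * M" using M R N by (auto simp: k_def B_def)
      then show ?thesis using Mpos B(2) by (simp add: field_simps power2_eq_square)
    qed
    have D: "M\<^sup>2 - k\<^sup>2 * R > 0"
      using N
    proof
      assume "N = 3"
      then have "M\<^sup>2 - k\<^sup>2 * R = 16 * R\<^sup>2 + 15 * R + 25"
        by (simp add: M k_def B_def power2_eq_square algebra_simps)
      then show ?thesis using R by (simp add: add_pos_nonneg)
    next
      assume "N \<in> {4}"
      then have "M\<^sup>2 - k\<^sup>2 * R = 16 * R\<^sup>2 + 44 * R + 100"
        by (simp add: M k_def B_def power2_eq_square algebra_simps)
      then show ?thesis using R by (simp add: add_pos_nonneg)
    qed
    have per_direction: "B * (2 / M - (4 * k - 2 * k\<^sup>2 / M) / (M\<^sup>2 - k\<^sup>2 * R) * (of_int (n j))\<^sup>2)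
        \<le> tail_weight N j n - head_weight N j n" if j: "j \<in> {1..N}" for j
    proof -
      define x where "x = real_of_int (n j)"
      have xR: "x\<^sup>2 \<le> R" using coord_sq_le_sqn[OF j, of n] by (simp add: x_def R_def)
      note sq1 = sqn_basis_vec[OF j]
      have "n \<noteq> basis_vec j" using 2 sq1 by auto
      moreover have "translate n (basis_vec j) \<noteq> origin"
      proof
        assume "translate n (basis_vec j) = origin"
        then have "n = (\<lambda>i. - basis_vec j i)"
          by (auto simp: translate_def origin_def fun_eq_iff eq_neg_iff_add_eq_0)
        then have "sqn {1..N} n = sqn {1..N} (basis_vec j)" by (simp add: sqn_def)
        then show False using sq1 2 by simp
      qed
      ultimately have "tail_weight N j n - head_weight N j n
          = B * (2 * x + 1) / (M + k * x) - B * (2 * x - 1) / (M - k * x)"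
        by (simp add: tail_weight_def head_weight_def M_def k_def B_def x_def)
      also have "\<dots> = B * (2 / M - (4 * k - 2 * k\<^sup>2 / M) / (M\<^sup>2 - k\<^sup>2 * x\<^sup>2) * x\<^sup>2)"
      proof -
        have p: "M + k * x > 0" "M - k * x > 0"
          using edge_denom_dominates[OF N j, of n] by (simp_all add: M_def k_def x_def)
        have f: "M\<^sup>2 - k\<^sup>2 * x\<^sup>2 = (M + k * x) * (M - k * x)" by (simp add: power2_eq_square algebra_simps)
        show ?thesis unfolding f using p Mpos by (simp add: divide_simps) algebra
      qed
      finally have eq: "tail_weight N j n - head_weight N j n = \<dots>" .
      \<comment> \<open>The chord over \<open>[0, R]\<close>: the denominator is smallest at \<open>x\<^sup>2 = R\<close>.\<close>
      have "(4 * k - 2 * k\<^sup>2 / M) / (M\<^sup>2 - k\<^sup>2 * x\<^sup>2) \<le> (4 * k - 2 * k\<^sup>2 / M) / (M\<^sup>2 - k\<^sup>2 * R)"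
      proof (rule divide_left_mono)
        show "M\<^sup>2 - k\<^sup>2 * R \<le> M\<^sup>2 - k\<^sup>2 * x\<^sup>2" using xR by (simp add: mult_left_mono)
        then show "0 < (M\<^sup>2 - k\<^sup>2 * x\<^sup>2) * (M\<^sup>2 - k\<^sup>2 * R)" using D by (simp add: mult_pos_pos)
      qed (rule kM)
      then have "(4 * k - 2 * k\<^sup>2 / M) / (M\<^sup>2 - k\<^sup>2 * x\<^sup>2) * x\<^sup>2 \<le> (4 * k - 2 * k\<^sup>2 / M) / (M\<^sup>2 - k\<^sup>2 * R) * x\<^sup>2"
        by (rule mult_right_mono) simp
      then show ?thesis unfolding eq using B by (simp add: x_def)
    qed
    have "hardy_const N / real (sqn {1..N} n) = B\<^sup>2 / (4 * R)"
      by (simp add: hardy_const_def B_def R_def)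
    also have "\<dots> \<le> B * (2 * real N / M - (4 * k - 2 * k\<^sup>2 / M) / (M\<^sup>2 - k\<^sup>2 * R) * R)"
      using N
    proof
      assume N3: "N = 3"
      then have v: "B = 1" "k = 5" "M = 4 * R + 5" by (simp_all add: B_def k_def M)
      have d: "M\<^sup>2 - k\<^sup>2 * R = 16 * R\<^sup>2 + 15 * R + 25" by (simp add: v power2_eq_square algebra_simps)
      have p: "16 * R\<^sup>2 + 15 * R + 25 > 0" using D d by simp
      have "20 * R\<^sup>2 + 425 * R - 125 \<ge> 0" using R zero_le_power2[of R] by linarith
      have "B * (2 * real N / M - (4 * k - 2 * k\<^sup>2 / M) / (M\<^sup>2 - k\<^sup>2 * R) * R) - B\<^sup>2 / (4 * R)
          = (20 * R\<^sup>2 + 425 * R - 125) / (4 * R * M * (16 * R\<^sup>2 + 15 * R + 25))"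
        unfolding d using Mpos p R unfolding v N3 by (simp add: divide_simps) algebra
      also have "\<dots> \<ge> 0" using \<open>20 * R\<^sup>2 + 425 * R - 125 \<ge> 0\<close> Mpos p R by simp
      finally show ?thesis by simp
    next
      assume "N \<in> {4}"
      then have N4: "N = 4" and v: "B = 2" "k = 6" "M = 4 * R + 10" by (simp_all add: B_def k_def M)
      have d: "M\<^sup>2 - k\<^sup>2 * R = 16 * R\<^sup>2 + 44 * R + 100" by (simp add: v power2_eq_square algebra_simps)
      have p: "16 * R\<^sup>2 + 44 * R + 100 > 0" using D d by simp
      have "32 * R\<^sup>2 + 760 * R - 1000 \<ge> 0" using R zero_le_power2[of R] by linarith
      have "B * (2 * real N / M - (4 * k - 2 * k\<^sup>2 / M) / (M\<^sup>2 - k\<^sup>2 * R) * R) - B\<^sup>2 / (4 * R)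
          = (32 * R\<^sup>2 + 760 * R - 1000) / (R * M * (16 * R\<^sup>2 + 44 * R + 100))"
        unfolding d using Mpos p R unfolding v N4 by (simp add: divide_simps) algebra
      also have "\<dots> \<ge> 0" using \<open>32 * R\<^sup>2 + 760 * R - 1000 \<ge> 0\<close> Mpos p R by simp
      finally show ?thesis by simp
    qed
    also have "\<dots> = (\<Sum>j=1..N. B * (2 / M - (4 * k - 2 * k\<^sup>2 / M) / (M\<^sup>2 - k\<^sup>2 * R) * (of_int (n j))\<^sup>2))"
    proof -
      have pull: "(\<Sum>j=1..N. B * (2 / M - c * (of_int (n j))\<^sup>2)) = B * (2 * real N / M - c * R)" for c
        by (simp add: R_def real_sqn sum_subtractf sum_distrib_left[symmetric])
      show ?thesis by (rule pull[symmetric])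
    qed
    also have "\<dots> \<le> (\<Sum>j=1..N. tail_weight N j n - head_weight N j n)"
      by (rule sum_mono) (rule per_direction)
    finally show ?thesis .
  qed
qed

lemma hardy_inequality:
  assumes N: "N \<in> {3, 4}" and u: "admissible N u"
  shows "hardy_const N * hardy_sum N u \<le> energy N u"
proof -
  let ?F = "{n. n \<in> lattice N \<and> u n \<noteq> 0}"
  have u0: "u origin = 0" and F: "finite ?F" using u by (auto simp: admissible_def)
  have "hardy_sum N u = (\<Sum>n\<in>?F. (cmod (u n))\<^sup>2 / (enorm N n)\<^sup>2)"
    unfolding hardy_sum_def by (rule infsum_finite_support) (use F u0 in auto)
  then have "hardy_const N * hardy_sum N u
      = (\<Sum>n\<in>?F. hardy_const N / real (sqn {1..N} n) * (cmod (u n))\<^sup>2)"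
    by (simp add: sum_distrib_left enorm_sq)
  also have "\<dots> \<le> (\<Sum>n\<in>?F. (\<Sum>j=1..N. tail_weight N j n - head_weight N j n) * (cmod (u n))\<^sup>2)"
    by (intro sum_mono mult_right_mono weight_sum_ge[OF N]) (use u0 in auto)
  also have "\<dots> \<le> energy N u"
    by (rule energy_ge_weighted_sum) (use F weighted_edge_inequality[where u = u, OF N _ u0] in auto)
  finally show ?thesis .
qed

section \<open>Upper bound by the truncated ground state\<close>

definition cube :: "nat set \<Rightarrow> nat \<Rightarrow> (nat \<Rightarrow> int) set" where
  "cube J p = {n \<in> lat J. \<forall>i. n i \<in> {- int p..int p}}"

lemma card_cube:
  assumes "finite J"
  shows "finite (cube J p) \<and> card (cube J p) = (2 * p + 1) ^ card J"
  using assms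
proof (induction J rule: finite_induct)
  case empty
  have "cube {} p = {origin}" by (auto simp: cube_def lat_def origin_def)
  then show ?case by simp
next
  case (insert j J)
  let ?I = "{- int p..int p}"
  have sub: "?I \<times> cube J p \<subseteq> UNIV \<times> lat J" by (auto simp: cube_def)
  have "cube (insert j J) p = (\<lambda>(x, n). n(j := x)) ` (?I \<times> cube J p)" (is "?L = ?R")
  proof (intro equalityI subsetI)
    fix n assume n: "n \<in> ?L"
    then have "(n j, n(j := 0)) \<in> ?I \<times> cube J p" by (auto simp: cube_def lat_def)
    moreover have "n = (case (n j, n(j := 0)) of (x, n) \<Rightarrow> n(j := x))" by simp
    ultimately show "n \<in> ?R" by (rule rev_image_eqI)
  next
    fix n assume "n \<in> ?R"
    then show "n \<in> ?L" by (auto simp: cube_def lat_def)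
  qed
  moreover have "card (?I \<times> cube J p) = (2 * p + 1) ^ Suc (card J)"
  proof -
    have "card ?I = 2 * p + 1" by (simp add: nat_eq_iff)
    then show ?thesis using insert(3) by (simp only: card_cartesian_product power_Suc)
  qed
  ultimately show ?case
    using inj_lat_insert[OF insert(2) sub] insert(1-3) by (simp add: card_image)
qed

lemma card_ball_le:
  assumes "finite J"
  shows "card {n \<in> lat J. sqn J n \<le> p\<^sup>2} \<le> (2 * p + 1) ^ card J"
proof -
  have "{n \<in> lat J. sqn J n \<le> p\<^sup>2} \<subseteq> cube J p"
  proof
    fix n assume n: "n \<in> {n \<in> lat J. sqn J n \<le> p\<^sup>2}"
    have "nat \<bar>n i\<bar> \<le> p" for i
    proof (cases "i \<in> J")
      case True
      have "sqn J n \<le> p\<^sup>2" using n by simp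
      then have "(nat \<bar>n i\<bar>)\<^sup>2 \<le> p\<^sup>2" using sqn_remove[OF assms True, of n] by linarith
      then show ?thesis using power2_nat_le_eq_le by blast
    next
      case False
      then show ?thesis using n by (simp add: lat_def)
    qed
    then have "\<bar>n i\<bar> \<le> int p" for i by (simp add: nat_le_iff)
    then have "n i \<in> {- int p..int p}" for i by (metis abs_le_iff atLeastAtMost_iff minus_le_iff)
    then show "n \<in> cube J p" using n by (simp add: cube_def)
  qed
  then have "card {n \<in> lat J. sqn J n \<le> p\<^sup>2} \<le> card (cube J p)"
    using card_cube[OF assms, of p] by (intro card_mono) auto
  then show ?thesis using card_cube[OF assms, of p] by simp
qed

lemma card_ball_ge:
  assumes "finite J"
  shows "(2 * p + 1) ^ card J \<le> card {n \<in> lat J. sqn J n \<le> card J * p\<^sup>2}"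
proof -
  have "cube J p \<subseteq> {n \<in> lat J. sqn J n \<le> card J * p\<^sup>2}"
  proof
    fix n assume n: "n \<in> cube J p"
    have "(nat \<bar>n i\<bar>)\<^sup>2 \<le> p\<^sup>2" for i
    proof -
      have "n i \<in> {- int p..int p}" using n by (simp add: cube_def)
      then have "nat \<bar>n i\<bar> \<le> p" by (simp add: abs_le_iff nat_le_iff)
      then show ?thesis by simp
    qed
    then have "sqn J n \<le> (\<Sum>i\<in>J. p\<^sup>2)" unfolding sqn_def by (intro sum_mono) auto
    then show "n \<in> {n \<in> lat J. sqn J n \<le> card J * p\<^sup>2}" using n by (simp add: cube_def)
  qed
  then have "card (cube J p) \<le> card {n \<in> lat J. sqn J n \<le> card J * p\<^sup>2}"
    by (rule card_mono[OF finite_ball_lat[OF assms]])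
  then show ?thesis using card_cube[OF assms, of p] by simp
qed

lemma square_powr_minus_half:
  fixes x :: real
  assumes "x > 0"
  shows "(x\<^sup>2) powr (- (real N / 2)) = 1 / x ^ N"
proof -
  have "(x\<^sup>2) powr (- (real N / 2)) = (x powr 2) powr (- (real N / 2))" using assms by simp
  also have "\<dots> = x powr (- real N)" unfolding powr_powr by simp
  also have "\<dots> = 1 / x powr real N" by (rule powr_minus_divide)
  also have "\<dots> = 1 / x ^ N" using assms by (simp only: powr_realpow)
  finally show ?thesis .
qed

text \<open>
  The truncated sum of \<open>\<bar>n\<bar>\<close> to the power \<open>- N\<close>, which grows like the logarithm of the radius. The origin contributes
  nothing since \<open>0 powr a = 0\<close>.
\<close>

definition log_sum :: "nat \<Rightarrow> nat \<Rightarrow> real" where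
  "log_sum N k = (\<Sum>n | n \<in> lat {1..N} \<and> sqn {1..N} n \<le> k. real (sqn {1..N} n) powr (- (real N / 2)))"

lemma log_sum_diff:
  assumes "a \<le> b"
  shows "log_sum N b - log_sum N a
    = (\<Sum>n\<in>{n \<in> lat {1..N}. sqn {1..N} n \<le> b} - {n \<in> lat {1..N}. sqn {1..N} n \<le> a}.
         real (sqn {1..N} n) powr (- (real N / 2)))"
  unfolding log_sum_def
  by (subst sum_diff) (use assms finite_ball_lat[of "{1..N}"] in auto)

lemma log_sum_mono: "a \<le> b \<Longrightarrow> log_sum N a \<le> log_sum N b"
  using log_sum_diff[of a b N] by (smt (verit) powr_ge_zero sum_nonneg)

lemma log_sum_annulus_le:
  assumes "0 < p" "p \<le> r"
  shows "log_sum N (r\<^sup>2) \<le> log_sum N (p\<^sup>2) + (2 * real r + 1) ^ N / real p ^ N"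
proof -
  let ?A = "{n \<in> lat {1..N}. sqn {1..N} n \<le> r\<^sup>2} - {n \<in> lat {1..N}. sqn {1..N} n \<le> p\<^sup>2}"
  have fin: "finite {n \<in> lat {1..N}. sqn {1..N} n \<le> r\<^sup>2}" by (rule finite_ball_lat) simp
  have "log_sum N (r\<^sup>2) - log_sum N (p\<^sup>2) = (\<Sum>n\<in>?A. real (sqn {1..N} n) powr (- (real N / 2)))"
    by (rule log_sum_diff) (use assms in simp)
  also have "\<dots> \<le> (\<Sum>n\<in>?A. 1 / real p ^ N)"
  proof (rule sum_mono)
    fix n assume "n \<in> ?A"
    then have "p\<^sup>2 \<le> sqn {1..N} n" by auto
    then have "(real p)\<^sup>2 \<le> real (sqn {1..N} n)" by (simp flip: of_nat_power)
    then have "real (sqn {1..N} n) powr (- (real N / 2)) \<le> ((real p)\<^sup>2) powr (- (real N / 2))"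
      using assms by (intro powr_mono2') auto
    also have "((real p)\<^sup>2) powr (- (real N / 2)) = 1 / real p ^ N"
      using assms by (intro square_powr_minus_half) simp
    finally show "real (sqn {1..N} n) powr (- (real N / 2)) \<le> 1 / real p ^ N" .
  qed
  also have "\<dots> = real (card ?A) * (1 / real p ^ N)" by simp
  also have "\<dots> \<le> (2 * real r + 1) ^ N * (1 / real p ^ N)"
  proof (rule mult_right_mono)
    have "card ?A \<le> (2 * r + 1) ^ N"
      using card_ball_le[of "{1..N}" r] card_mono[OF fin, of ?A] by force
    then have "real (card ?A) \<le> real ((2 * r + 1) ^ N)" by (rule of_nat_mono)
    then show "real (card ?A) \<le> (2 * real r + 1) ^ N" by (simp add: add.commute)
  qed simp
  finally show ?thesis by simp
qed

lemma power_add_le_power_sum: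
  fixes a b :: nat
  assumes "N > 0"
  shows "a ^ N + b ^ N \<le> (a + b) ^ N"
  using assms
proof (induction N rule: nat_induct_non_zero)
  case (Suc n)
  have "a ^ Suc n + b ^ Suc n \<le> (a + b) * (a ^ n + b ^ n)" by (simp add: algebra_simps)
  also have "\<dots> \<le> (a + b) * (a + b) ^ n" using Suc by (intro mult_left_mono) auto
  finally show ?case by simp
qed simp

text \<open>
  The ball of squared radius \<open>N (2p)\<^sup>2\<close> contains a cube of side \<open>4p + 1\<close>, and the ball of radius \<open>p\<close> is
  contained in one of side \<open>2p + 1\<close>; the annulus between them therefore has at least \<open>(2p)\<close> to the power \<open>N\<close> points,
  each with a summand of the reciprocal order.
\<close>

lemma log_sum_annulus_ge:
  assumes N: "N > 0" and p: "p > 0"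
  shows "log_sum N (p\<^sup>2) + real N powr (- (real N / 2)) \<le> log_sum N ((2 * N * p)\<^sup>2)"
proof -
  let ?b = "N * (2 * p)\<^sup>2"
  let ?A = "{n \<in> lat {1..N}. sqn {1..N} n \<le> ?b} - {n \<in> lat {1..N}. sqn {1..N} n \<le> p\<^sup>2}"
  have fin: "finite {n \<in> lat {1..N}. sqn {1..N} n \<le> k}" for k by (rule finite_ball_lat) simp
  have le: "p\<^sup>2 \<le> ?b" using N by (simp add: power_mult_distrib)
  have "(2 * p + 1) ^ N + (2 * p) ^ N \<le> (2 * p + 1 + 2 * p) ^ N"
    by (rule power_add_le_power_sum[OF N])
  also have "\<dots> \<le> card {n \<in> lat {1..N}. sqn {1..N} n \<le> ?b}"
    using card_ball_ge[of "{1..N}" "2 * p"] by simp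
  also have "\<dots> = card ?A + card {n \<in> lat {1..N}. sqn {1..N} n \<le> p\<^sup>2}"
  proof -
    have sub: "{n \<in> lat {1..N}. sqn {1..N} n \<le> p\<^sup>2} \<subseteq> {n \<in> lat {1..N}. sqn {1..N} n \<le> ?b}"
      using le by (auto intro: order_trans)
    show ?thesis using card_Diff_subset[OF fin sub] card_mono[OF fin sub] by simp
  qed
  also have "card {n \<in> lat {1..N}. sqn {1..N} n \<le> p\<^sup>2} \<le> (2 * p + 1) ^ N"
    using card_ball_le[of "{1..N}" p] by simp
  finally have "(2 * p) ^ N \<le> card ?A" by simp
  then have "real ((2 * p) ^ N) \<le> real (card ?A)" by (rule of_nat_mono)
  then have cA: "(2 * real p) ^ N \<le> real (card ?A)" by simp
  have bN: "(real N * (2 * real p)\<^sup>2) powr (- (real N / 2)) = real N powr (- (real N / 2)) / (2 * real p) ^ N"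
  proof -
    have "((2 * real p)\<^sup>2) powr (- (real N / 2)) = 1 / (2 * real p) ^ N"
      using p by (intro square_powr_minus_half) simp
    then show ?thesis by (simp add: powr_mult)
  qed
  have "real N powr (- (real N / 2)) = (2 * real p) ^ N * (real N * (2 * real p)\<^sup>2) powr (- (real N / 2))"
    unfolding bN using p by simp
  also have "\<dots> \<le> real (card ?A) * (real N * (2 * real p)\<^sup>2) powr (- (real N / 2))"
    by (rule mult_right_mono[OF cA]) simp
  also have "\<dots> = (\<Sum>n\<in>?A. (real N * (2 * real p)\<^sup>2) powr (- (real N / 2)))" by simp
  also have "\<dots> \<le> (\<Sum>n\<in>?A. real (sqn {1..N} n) powr (- (real N / 2)))"
  proof (rule sum_mono)
    fix n assume n: "n \<in> ?A"
    then have "real (sqn {1..N} n) \<le> real ?b" by (simp only: of_nat_le_iff) simp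
    moreover have "sqn {1..N} n > 0" using n by auto
    ultimately show "(real N * (2 * real p)\<^sup>2) powr (- (real N / 2)) \<le> real (sqn {1..N} n) powr (- (real N / 2))"
      by (intro powr_mono2') auto
  qed
  also have "\<dots> = log_sum N ?b - log_sum N (p\<^sup>2)" by (rule log_sum_diff[OF le, symmetric])
  also have "log_sum N ?b \<le> log_sum N ((2 * N * p)\<^sup>2)"
    by (rule log_sum_mono) (use N in \<open>simp add: power_mult_distrib power2_eq_square\<close>)
  finally show ?thesis by simp
qed

lemma log_sum_unbounded:
  assumes N: "N > 0"
  shows "\<exists>p>0. log_sum N (p\<^sup>2) \<ge> B"
proof -
  define c where "c = real N powr (- (real N / 2))"
  have c: "c > 0" using N by (simp add: c_def)
  \<comment> \<open>Each factor \<open>2 N\<close> in the radius adds at least \<open>c\<close>.\<close>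
  have "real i * c \<le> log_sum N (((2 * N) ^ i)\<^sup>2)" for i
  proof (induction i)
    case 0
    show ?case by (simp add: log_sum_def sum_nonneg)
  next
    case (Suc i)
    have "real (Suc i) * c \<le> log_sum N (((2 * N) ^ i)\<^sup>2) + c" using Suc by (simp add: algebra_simps)
    also have "\<dots> \<le> log_sum N ((2 * N * (2 * N) ^ i)\<^sup>2)"
      unfolding c_def by (rule log_sum_annulus_ge[OF N]) (use N in simp)
    finally show ?case by simp
  qed
  moreover obtain i where "B < real i * c" using c reals_Archimedean3 by blast
  ultimately have "B \<le> log_sum N (((2 * N) ^ i)\<^sup>2)" by (meson less_le_trans less_imp_le)
  then show ?thesis using N by (intro exI[of _ "(2 * N) ^ i"]) auto
qed

lemma gradient_factor_tendsto:
  fixes b c :: real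
  shows "((\<lambda>t. (t - 2 * sqrt t) powr (- (c + 1)) * (t + b * sqrt t + b) * t powr c) \<longlongrightarrow> 1) at_top"
  by real_asymp

text \<open>
  The ground state \<open>\<bar>n\<bar>\<close> to the power \<open>- (N - 2) / 2\<close> as a function of the squared length \<open>k\<close>.
  The value 0 at the origin is forced by the side condition on test functions.
\<close>

definition riesz :: "nat \<Rightarrow> nat \<Rightarrow> real" where
  "riesz N k = (if k = 0 then 0 else real k powr (- ((real N - 2) / 4)))"

lemma powr_lipschitz:
  fixes b s t t' :: real
  assumes "b \<ge> 0" "0 < s" "s \<le> t" "s \<le> t'"
  shows "\<bar>t' powr (- b) - t powr (- b)\<bar> \<le> b * s powr (- b - 1) * \<bar>t' - t\<bar>"
proof -
  have "norm (t' powr (- b) - t powr (- b)) \<le> b * s powr (- b - 1) * norm (t' - t)"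
  proof (rule field_differentiable_bound[where S = "{s..}" and f' = "\<lambda>y. - b * y powr (- b - 1)"])
    fix y assume y: "y \<in> {s..}"
    then show "((\<lambda>y. y powr (- b)) has_field_derivative - b * y powr (- b - 1)) (at y within {s..})"
      using assms by (auto intro!: derivative_eq_intros)
    have "y powr (- b - 1) \<le> s powr (- b - 1)" using y assms by (intro powr_mono2') auto
    then show "norm (- b * y powr (- b - 1)) \<le> b * s powr (- b - 1)"
      using assms by (simp add: abs_mult mult_left_mono)
  qed (use assms in auto)
  then show ?thesis by simp
qed

text \<open>
  A step in direction \<open>j\<close> changes the squared length by \<open>2 n\<^sub>j + 1\<close>, so the mean value theorem gives
  the gradient of the power function times \<open>1 + o(1)\<close>, uniformly in the direction of \<open>n\<close>; summing \<open>(2 n\<^sub>j + 1)\<^sup>2\<close>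
  over \<open>j\<close> gives \<open>4 \<bar>n\<bar>\<^sup>2\<close> to leading order.
\<close>

lemma riesz_gradient_le:
  assumes N: "N \<ge> 3" and e: "e > 0"
  shows "\<exists>K>0. \<forall>n. sqn {1..N} n \<ge> K \<longrightarrow>
    (\<Sum>j=1..N. (riesz N (sqn {1..N} (translate n (basis_vec j))) - riesz N (sqn {1..N} n))\<^sup>2)
      \<le> (1 + e) * hardy_const N * real (sqn {1..N} n) powr (- (real N / 2))"
proof -
  define F where "F t = (t - 2 * sqrt t) powr (- (real N / 2 + 1)) * (t + real N * sqrt t + real N) * t powr (real N / 2)" for t
  have "\<forall>\<^sub>F t in at_top. F t < 1 + e"
    using gradient_factor_tendsto[of "real N / 2" "real N"] e unfolding F_def
    by (intro order_tendstoD(2)) auto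
  then obtain K0 where K0: "\<And>t. t \<ge> K0 \<Longrightarrow> F t < 1 + e"
    by (auto simp: eventually_at_top_linorder)
  define K where "K = max 16 (nat \<lceil>K0\<rceil>)"
  show ?thesis
  proof (intro exI[of _ K] conjI allI impI)
    show "K > 0" by (simp add: K_def)
    fix n assume n: "sqn {1..N} n \<ge> K"
    define t where "t = real (sqn {1..N} n)"
    \<comment> \<open>A lower bound for the squared length at both ends of every edge at \<open>n\<close>.\<close>
    define s where "s = t - 2 * sqrt t"
    define b where "b = (real N - 2) / 4"
    have t16: "t \<ge> 16" and tK0: "t \<ge> K0" using n by (auto simp: t_def K_def)
    have "4 \<le> sqrt t" using t16 real_sqrt_le_mono[of 16 t] by simp
    then have "4 * sqrt t \<le> sqrt t * sqrt t" by (rule mult_right_mono) (use t16 in simp)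
    then have s: "0 < s" using t16 by (simp add: s_def)
    have b: "b \<ge> 0" using N by (simp add: b_def)
    have xs: "\<bar>real_of_int (n j)\<bar> \<le> sqrt t" if "j \<in> {1..N}" for j
    proof -
      have "(real_of_int (n j))\<^sup>2 \<le> t" unfolding t_def by (rule coord_sq_le_sqn[OF that])
      then show ?thesis using real_le_rsqrt[of "\<bar>real_of_int (n j)\<bar>" t] by simp
    qed
    have "(riesz N (sqn {1..N} (translate n (basis_vec j))) - riesz N (sqn {1..N} n))\<^sup>2
        \<le> (b * s powr (- b - 1))\<^sup>2 * (2 * of_int (n j) + 1)\<^sup>2" if j: "j \<in> {1..N}" for j
    proof -
      define t' where "t' = real (sqn {1..N} (translate n (basis_vec j)))"
      have t': "t' = t + 2 * of_int (n j) + 1" using sqn_translate[OF j, of n] by (simp add: t'_def t_def)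
      have "s \<le> t'" "s \<le> t" using xs[OF j] t16 by (auto simp: s_def t')
      then have lip: "\<bar>t' powr (- b) - t powr (- b)\<bar> \<le> b * s powr (- b - 1) * \<bar>t' - t\<bar>"
        using s b by (intro powr_lipschitz)
      have "t' > 0" "t > 0" using s \<open>s \<le> t'\<close> \<open>s \<le> t\<close> by linarith+
      then have "riesz N (sqn {1..N} (translate n (basis_vec j))) = t' powr (- b)"
        and "riesz N (sqn {1..N} n) = t powr (- b)"
        by (simp_all add: riesz_def b_def t'_def t_def)
      moreover have "t' - t = 2 * of_int (n j) + 1" using t' by simp
      ultimately have "\<bar>riesz N (sqn {1..N} (translate n (basis_vec j))) - riesz N (sqn {1..N} n)\<bar>
          \<le> b * s powr (- b - 1) * \<bar>2 * of_int (n j) + 1\<bar>" using lip by simp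
      then have "\<bar>riesz N (sqn {1..N} (translate n (basis_vec j))) - riesz N (sqn {1..N} n)\<bar>\<^sup>2
          \<le> (b * s powr (- b - 1) * \<bar>2 * of_int (n j) + 1\<bar>)\<^sup>2"
        by (intro power_mono) auto
      then show ?thesis by (simp add: power_mult_distrib)
    qed
    then have "(\<Sum>j=1..N. (riesz N (sqn {1..N} (translate n (basis_vec j))) - riesz N (sqn {1..N} n))\<^sup>2)
        \<le> (\<Sum>j=1..N. (b * s powr (- b - 1))\<^sup>2 * (2 * of_int (n j) + 1)\<^sup>2)"
      by (rule sum_mono)
    also have "\<dots> = (b * s powr (- b - 1))\<^sup>2 * (\<Sum>j=1..N. (2 * of_int (n j) + 1)\<^sup>2)"
      by (simp add: sum_distrib_left)
    also have "\<dots> \<le> (b * s powr (- b - 1))\<^sup>2 * (4 * (t + real N * sqrt t + real N))"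
    proof (rule mult_left_mono)
      have "(\<Sum>j=1..N. (2 * real_of_int (n j) + 1)\<^sup>2) \<le> (\<Sum>j=1..N. 4 * (real_of_int (n j))\<^sup>2 + (4 * sqrt t + 1))"
      proof (rule sum_mono)
        fix j assume "j \<in> {1..N}"
        then show "(2 * real_of_int (n j) + 1)\<^sup>2 \<le> 4 * (real_of_int (n j))\<^sup>2 + (4 * sqrt t + 1)"
          using xs[of j] by (simp add: power2_eq_square algebra_simps)
      qed
      also have "\<dots> = 4 * t + real N * (4 * sqrt t + 1)"
        unfolding t_def real_sqn by (simp add: sum.distrib sum_distrib_left)
      also have "\<dots> \<le> 4 * (t + real N * sqrt t + real N)" by (simp add: algebra_simps)
      finally show "(\<Sum>j=1..N. (2 * real_of_int (n j) + 1)\<^sup>2) \<le> 4 * (t + real N * sqrt t + real N)" .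
    qed simp
    also have "\<dots> = hardy_const N * (s powr (- (real N / 2 + 1)) * (t + real N * sqrt t + real N))"
    proof -
      have "(s powr (- b - 1))\<^sup>2 = s powr (- b - 1 + (- b - 1))"
        by (simp only: power2_eq_square powr_add)
      also have "- b - 1 + (- b - 1) = - (real N / 2 + 1)" by (simp add: b_def field_simps)
      finally have "(s powr (- b - 1))\<^sup>2 = s powr (- (real N / 2 + 1))" .
      then show ?thesis by (simp add: power_mult_distrib hardy_const_def b_def power_divide)
    qed
    also have "\<dots> \<le> hardy_const N * ((1 + e) * t powr (- (real N / 2)))"
    proof (rule mult_left_mono)
      have "s powr (- (real N / 2 + 1)) * (t + real N * sqrt t + real N) = F t * t powr (- (real N / 2))"
        using t16 by (simp add: F_def s_def powr_minus)
      also have "\<dots> \<le> (1 + e) * t powr (- (real N / 2))"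
        using K0[OF tK0] by (intro mult_right_mono) auto
      finally show "s powr (- (real N / 2 + 1)) * (t + real N * sqrt t + real N) \<le> (1 + e) * t powr (- (real N / 2))" .
    qed (simp add: hardy_const_def)
    finally show "(\<Sum>j=1..N. (riesz N (sqn {1..N} (translate n (basis_vec j))) - riesz N (sqn {1..N} n))\<^sup>2)
        \<le> (1 + e) * hardy_const N * real (sqn {1..N} n) powr (- (real N / 2))"
      by (simp add: t_def mult_ac)
  qed
qed

text \<open>
  Subtracting the value at radius \<open>M\<close> and cutting at 0 produces finite support by a contraction of
  the values, so the energy per edge does not increase.
\<close>

definition truncated_riesz :: "nat \<Rightarrow> nat \<Rightarrow> nat \<Rightarrow> real" where
  "truncated_riesz N M k = max 0 (riesz N k - riesz N (M\<^sup>2))"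

lemma riesz_nonneg: "riesz N k \<ge> 0"
  by (simp add: riesz_def)

lemma riesz_antimono:
  assumes "N \<ge> 2" "0 < k" "k \<le> l"
  shows "riesz N l \<le> riesz N k"
  using assms by (auto simp: riesz_def intro!: powr_mono2')

lemma riesz_square:
  assumes "k > 0"
  shows "(riesz N k)\<^sup>2 / real k = real k powr (- (real N / 2))"
proof -
  have "(riesz N k)\<^sup>2 = real k powr (- ((real N - 2) / 4) + - ((real N - 2) / 4))"
    using assms by (simp only: riesz_def power2_eq_square powr_add) simp
  also have "- ((real N - 2) / 4) + - ((real N - 2) / 4) = - (real N / 2) + 1" by (simp add: field_simps)
  finally show ?thesis using assms powr_add[of "real k" "- (real N / 2)" 1] by simp
qed

lemma truncated_riesz_eq_0:
  assumes "N \<ge> 2" "M > 0" "k = 0 \<or> M\<^sup>2 \<le> k"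
  shows "truncated_riesz N M k = 0"
  using assms(3)
proof
  assume "k = 0"
  then show ?thesis using riesz_nonneg[of N "M\<^sup>2"] by (simp add: truncated_riesz_def riesz_def)
next
  assume "M\<^sup>2 \<le> k"
  then show ?thesis using riesz_antimono[of N "M\<^sup>2" k] assms by (simp add: truncated_riesz_def)
qed

text \<open>
  The points near the origin, where the gradient estimate does not apply yet, contribute an amount
  that does not depend on \<open>M\<close>.
\<close>

lemma energy_truncated_riesz_le:
  assumes N: "N \<ge> 3" and e: "e > 0"
  shows "\<exists>c0. \<forall>M>0. energy N (radial N (truncated_riesz N M))
    \<le> c0 + (1 + e) * hardy_const N * log_sum N ((M + 1)\<^sup>2)"
proof -
  let ?q = "\<lambda>n. sqn {1..N} n" and ?t = "\<lambda>j n. translate n (basis_vec j)"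
  define D where "D n = (\<Sum>j=1..N. (riesz N (?q (?t j n)) - riesz N (?q n))\<^sup>2)" for n
  obtain K where K: "K > 0" "\<And>n. ?q n \<ge> K \<Longrightarrow> D n \<le> (1 + e) * hardy_const N * real (?q n) powr (- (real N / 2))"
    using riesz_gradient_le[OF N e] by (auto simp: D_def)
  define c0 where "c0 = (\<Sum>n | n \<in> lat {1..N} \<and> ?q n \<le> K. D n)"
  have D0: "D n \<ge> 0" for n by (simp add: D_def sum_nonneg)
  have h: "hardy_const N \<ge> 0" by (simp add: hardy_const_def)
  show ?thesis
  proof (intro exI[of _ c0] allI impI)
    fix M :: nat assume M: "M > 0"
    let ?f = "truncated_riesz N M"
    let ?B = "{n. n \<in> lat {1..N} \<and> ?q n \<le> (M + 1)\<^sup>2}"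
    let ?C = "{n. n \<in> lat {1..N} \<and> ?q n \<le> K}"
    have fin: "finite ?B" "finite ?C" by (simp_all add: finite_ball_lat)
    have f0: "?f k = 0" if "k \<ge> M\<^sup>2" for k
      by (rule truncated_riesz_eq_0) (use that M N in auto)
    have lip: "\<bar>?f k - ?f l\<bar> \<le> \<bar>riesz N k - riesz N l\<bar>" for k l
      by (auto simp: truncated_riesz_def max_def)
    \<comment> \<open>A step shortens a vector by at most 1, so edges from points beyond radius \<open>M + 1\<close> miss the support.\<close>
    have far: "?f (?q (?t j n)) = 0 \<and> ?f (?q n) = 0" if j: "j \<in> {1..N}" and n: "n \<in> lattice N - ?B" for j n
    proof -
      have big: "(M + 1)\<^sup>2 < ?q n" using n by (auto simp: lattice_eq_lat)
      define r where "r = sqrt (real (?q n))"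
      have r2: "r\<^sup>2 = real (?q n)" by (simp add: r_def)
      have "real ((M + 1)\<^sup>2) < real (?q n)" using big by (simp only: of_nat_less_iff)
      then have rM: "real M + 1 < r" unfolding r_def by (intro real_less_rsqrt) (simp add: add.commute)
      have "(real_of_int (n j))\<^sup>2 \<le> real (?q n)"
        by (rule coord_sq_le_sqn[OF j])
      then have xr: "\<bar>real_of_int (n j)\<bar> \<le> r" unfolding r_def by (intro real_le_rsqrt) simp
      have "(r - 1)\<^sup>2 = r\<^sup>2 - 2 * r + 1" by (simp add: power2_eq_square algebra_simps)
      then have "real (?q (?t j n)) \<ge> (r - 1)\<^sup>2"
        using sqn_translate[OF j, of n] r2 xr by linarith
      moreover have "(r - 1)\<^sup>2 \<ge> (real M)\<^sup>2" using rM by (intro power_mono) auto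
      ultimately have "real (M\<^sup>2) \<le> real (?q (?t j n))" unfolding of_nat_power by linarith
      then have "M\<^sup>2 \<le> ?q (?t j n)" by (simp only: of_nat_le_iff)
      moreover have "M\<^sup>2 \<le> ?q n" using big by (simp add: power2_eq_square)
      ultimately show ?thesis using f0 by blast
    qed
    have "energy N (radial N ?f) = (\<Sum>j=1..N. \<Sum>n\<in>?B. (?f (?q (?t j n)) - ?f (?q n))\<^sup>2)"
      unfolding energy_def
    proof (rule sum.cong[OF refl])
      fix j assume j: "j \<in> {1..N}"
      have "(\<Sum>\<^sub>\<infinity>n\<in>lattice N. (cmod (radial N ?f (?t j n) - radial N ?f n))\<^sup>2)
          = (\<Sum>\<^sub>\<infinity>n\<in>lattice N. (?f (?q (?t j n)) - ?f (?q n))\<^sup>2)"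
        by (simp add: radial_def flip: of_real_diff)
      also have "\<dots> = (\<Sum>n\<in>?B. (?f (?q (?t j n)) - ?f (?q n))\<^sup>2)"
        by (rule infsum_finite_support) (use fin far[OF j] in \<open>auto simp: lattice_eq_lat\<close>)
      finally show "(\<Sum>\<^sub>\<infinity>n\<in>lattice N. (cmod (radial N ?f (?t j n) - radial N ?f n))\<^sup>2)
          = (\<Sum>n\<in>?B. (?f (?q (?t j n)) - ?f (?q n))\<^sup>2)" .
    qed
    also have "\<dots> = (\<Sum>n\<in>?B. \<Sum>j=1..N. (?f (?q (?t j n)) - ?f (?q n))\<^sup>2)" by (rule sum.swap)
    also have "\<dots> \<le> (\<Sum>n\<in>?B. D n)"
      unfolding D_def by (intro sum_mono) (use lip in \<open>simp add: abs_le_square_iff\<close>)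
    also have "\<dots> = (\<Sum>n\<in>?B \<inter> ?C. D n) + (\<Sum>n\<in>?B - ?C. D n)"
      by (rule sum.Int_Diff[OF fin(1)])
    also have "(\<Sum>n\<in>?B \<inter> ?C. D n) \<le> c0"
      unfolding c0_def by (rule sum_mono2) (use fin D0 in auto)
    also have "(\<Sum>n\<in>?B - ?C. D n) \<le> (\<Sum>n\<in>?B - ?C. (1 + e) * hardy_const N * real (?q n) powr (- (real N / 2)))"
      by (intro sum_mono K(2)) auto
    also have "\<dots> \<le> (\<Sum>n\<in>?B. (1 + e) * hardy_const N * real (?q n) powr (- (real N / 2)))"
      by (rule sum_mono2) (use fin e h in auto)
    also have "\<dots> = (1 + e) * hardy_const N * log_sum N ((M + 1)\<^sup>2)"
      by (simp add: log_sum_def sum_distrib_left)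
    finally show "energy N (radial N ?f) \<le> c0 + (1 + e) * hardy_const N * log_sum N ((M + 1)\<^sup>2)" by simp
  qed
qed

text \<open>
  Up to radius \<open>m\<close>, a fixed fraction \<open>1 / T\<close> of the cut-off radius, the truncation costs only the factor
  \<open>1 - riesz N (T\<^sup>2)\<close>, because \<open>riesz\<close> is multiplicative.
\<close>

lemma hardy_sum_truncated_riesz_ge:
  assumes N: "N \<ge> 3" and m: "m > 0" and T: "T \<ge> 2"
  shows "(1 - riesz N (T\<^sup>2))\<^sup>2 * log_sum N (m\<^sup>2) \<le> hardy_sum N (radial N (truncated_riesz N (T * m)))"
proof -
  let ?f = "truncated_riesz N (T * m)"
  have f0: "?f k = 0" if "k = 0 \<or> (T * m)\<^sup>2 \<le> k" for k
    by (rule truncated_riesz_eq_0) (use that N m T in auto)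
  have T1: "riesz N (T\<^sup>2) \<le> 1" using riesz_antimono[of N 1 "T\<^sup>2"] N T by (simp add: riesz_def)
  have "(1 - riesz N (T\<^sup>2))\<^sup>2 * real k powr (- (real N / 2)) \<le> (?f k)\<^sup>2 / real k" if k: "k \<le> m\<^sup>2" for k
  proof (cases "k = 0")
    case False
    have "riesz N ((T * m)\<^sup>2) = riesz N (T\<^sup>2) * riesz N (m\<^sup>2)"
      using m T by (simp add: riesz_def powr_mult power_mult_distrib)
    also have "\<dots> \<le> riesz N (T\<^sup>2) * riesz N k"
      by (intro mult_left_mono riesz_antimono riesz_nonneg) (use N k False in auto)
    finally have "(1 - riesz N (T\<^sup>2)) * riesz N k \<le> ?f k" by (simp add: truncated_riesz_def algebra_simps)
    then have "((1 - riesz N (T\<^sup>2)) * riesz N k)\<^sup>2 \<le> (?f k)\<^sup>2"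
      using T1 riesz_nonneg[of N k] by (intro power_mono) auto
    then have "((1 - riesz N (T\<^sup>2)) * riesz N k)\<^sup>2 / real k \<le> (?f k)\<^sup>2 / real k"
      by (rule divide_right_mono) simp
    then show ?thesis using riesz_square[of k N] False by (simp add: power_mult_distrib flip: times_divide_eq_right)
  qed simp
  then have "(\<Sum>k\<le>m\<^sup>2. real (num_rep N k) * ((1 - riesz N (T\<^sup>2))\<^sup>2 * real k powr (- (real N / 2))))
      \<le> (\<Sum>k\<le>m\<^sup>2. real (num_rep N k) * ((?f k)\<^sup>2 / real k))"
    by (intro sum_mono mult_left_mono) auto
  also have "\<dots> \<le> (\<Sum>k\<le>(T * m)\<^sup>2. real (num_rep N k) * ((?f k)\<^sup>2 / real k))"
  proof (rule sum_mono2)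
    have "m \<le> T * m" using T by simp
    then show "{..m\<^sup>2} \<subseteq> {..(T * m)\<^sup>2}" by (simp add: power_mono)
  qed auto
  also have "\<dots> = hardy_sum N (radial N ?f)"
    by (rule hardy_sum_radial[symmetric]) (use f0 in auto)
  also have "(\<Sum>k\<le>m\<^sup>2. real (num_rep N k) * ((1 - riesz N (T\<^sup>2))\<^sup>2 * real k powr (- (real N / 2))))
      = (1 - riesz N (T\<^sup>2))\<^sup>2 * log_sum N (m\<^sup>2)"
    using sum_ball_radial[of "{1..N}" "\<lambda>k. real k powr (- (real N / 2))" "m\<^sup>2"]
    by (simp add: log_sum_def sum_distrib_left mult_ac)
  finally show ?thesis .
qed

text \<open>
  With \<open>T\<close> fixed and \<open>m\<close> growing, both the energy and the Hardy sum are governed by the same unbounded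
  quantity \<open>log_sum N (m\<^sup>2)\<close>: the annulus between the radii \<open>m\<close> and \<open>T m\<close> contributes a bounded amount.
  Comparing coefficients gives the claim.
\<close>

lemma sharp_const_mult_cutoff_le:
  assumes N: "N \<ge> 3" and e: "e > 0" and T: "T \<ge> 2" and C: "sharp_const N \<ge> 0"
  shows "sharp_const N * (1 - riesz N (T\<^sup>2))\<^sup>2 \<le> (1 + e) * hardy_const N"
proof -
  define a where "a = sharp_const N * (1 - riesz N (T\<^sup>2))\<^sup>2"
  define c where "c = (1 + e) * hardy_const N"
  have c: "c \<ge> 0" using e by (simp add: c_def hardy_const_def)
  obtain c0 where c0: "\<And>M. M > 0 \<Longrightarrow> energy N (radial N (truncated_riesz N M)) \<le> c0 + c * log_sum N ((M + 1)\<^sup>2)"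
    using energy_truncated_riesz_le[OF N e] by (auto simp: c_def)
  define b where "b = c0 + c * (5 * real T) ^ N"
  have "a * log_sum N (m\<^sup>2) \<le> b + c * log_sum N (m\<^sup>2)" if m: "m > 0" for m
  proof -
    let ?f = "truncated_riesz N (T * m)"
    have Tm: "T * m > 1" using m T by (metis Suc_1 less_le_trans mult.right_neutral mult_le_mono Suc_leI One_nat_def lessI)
    have adm: "admissible N (radial N ?f)"
    proof (rule admissible_radial)
      show "?f k = 0" if "k > (T * m)\<^sup>2" for k
        by (rule truncated_riesz_eq_0) (use that N m T in auto)
      show "?f 0 = 0" by (rule truncated_riesz_eq_0) (use N m T in auto)
      have "1 < (T * m)\<^sup>2" using Tm by (intro one_less_power) auto
      then have "real 1 < real ((T * m)\<^sup>2)" by (simp only: of_nat_less_iff)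
      then have "riesz N ((T * m)\<^sup>2) < 1"
        using N Tm by (simp add: riesz_def powr_less_one del: of_nat_power of_nat_mult)
      then show "?f 1 \<noteq> 0" by (simp add: truncated_riesz_def riesz_def)
      show "N \<ge> 1" using N by simp
    qed
    have "a * log_sum N (m\<^sup>2) \<le> sharp_const N * hardy_sum N (radial N ?f)"
      using mult_left_mono[OF hardy_sum_truncated_riesz_ge[OF N m T] C] by (simp add: a_def mult_ac)
    also have "\<dots> \<le> energy N (radial N ?f)" by (rule sharp_const_mult_le[OF adm])
    also have "\<dots> \<le> c0 + c * log_sum N ((T * m + 1)\<^sup>2)" using m T by (intro c0) simp
    also have "\<dots> \<le> c0 + c * (log_sum N (m\<^sup>2) + (5 * real T) ^ N)"
    proof (intro add_left_mono mult_left_mono c)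
      have "m \<le> T * m + 1" using T by (intro trans_le_add1) simp
      then have "log_sum N ((T * m + 1)\<^sup>2) \<le> log_sum N (m\<^sup>2) + (2 * real (T * m + 1) + 1) ^ N / real m ^ N"
        by (rule log_sum_annulus_le[OF m])
      also have "(2 * real (T * m + 1) + 1) ^ N / real m ^ N \<le> (5 * real T) ^ N"
      proof -
        have "real 1 \<le> real (T * m)" using m T by (intro of_nat_mono) simp
        then have "2 * real (T * m + 1) + 1 \<le> 5 * real T * real m" by simp
        then have "(2 * real (T * m + 1) + 1) ^ N \<le> (5 * real T * real m) ^ N" by (intro power_mono) auto
        then show ?thesis using m by (simp add: power_mult_distrib divide_le_eq)
      qed
      finally show "log_sum N ((T * m + 1)\<^sup>2) \<le> log_sum N (m\<^sup>2) + (5 * real T) ^ N" by simp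
    qed
    also have "\<dots> = b + c * log_sum N (m\<^sup>2)" by (simp add: b_def algebra_simps)
    finally show ?thesis .
  qed note bound = this
  have "a \<le> c"
  proof (rule ccontr)
    assume "\<not> a \<le> c"
    then have ac: "a - c > 0" by simp
    obtain m where m: "m > 0" "log_sum N (m\<^sup>2) \<ge> (b + 1) / (a - c)"
      using log_sum_unbounded[of N "(b + 1) / (a - c)"] N by auto
    then have "b + 1 \<le> (a - c) * log_sum N (m\<^sup>2)" using ac by (simp add: field_simps)
    then show False using bound[OF m(1)] by (simp add: algebra_simps)
  qed
  then show ?thesis by (simp add: a_def c_def)
qed

lemma sharp_const_le_hardy_const:
  assumes N: "N \<ge> 3"
  shows "sharp_const N \<le> hardy_const N"
proof (cases "sharp_const N \<ge> 0")
  case True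
  have "sharp_const N \<le> (1 + e) * hardy_const N" if e: "e > 0" for e
  proof (rule LIMSEQ_le_const2)
    have "(\<lambda>T. riesz N (T\<^sup>2)) \<longlonglongrightarrow> 0"
    proof -
      have "(\<lambda>T. real (T\<^sup>2) powr (- ((real N - 2) / 4))) \<longlonglongrightarrow> 0"
        by (rule tendsto_neg_powr) (use N in \<open>auto intro!: filterlim_pow_at_top filterlim_real_sequentially\<close>)
      then show ?thesis
        by (rule Lim_transform_eventually) (auto simp: riesz_def eventually_at_top_linorder intro!: exI[of _ 1])
    qed
    then have "(\<lambda>T. sharp_const N * (1 - riesz N (T\<^sup>2))\<^sup>2) \<longlonglongrightarrow> sharp_const N * (1 - 0)\<^sup>2"
      by (intro tendsto_intros)
    then show "(\<lambda>T. sharp_const N * (1 - riesz N (T\<^sup>2))\<^sup>2) \<longlonglongrightarrow> sharp_const N" by simp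
    show "\<exists>T0. \<forall>T\<ge>T0. sharp_const N * (1 - riesz N (T\<^sup>2))\<^sup>2 \<le> (1 + e) * hardy_const N"
      using sharp_const_mult_cutoff_le[OF N e _ True] by blast
  qed
  note le = this
  show ?thesis
  proof (rule field_le_epsilon)
    fix d :: real assume d: "d > 0"
    have h: "hardy_const N > 0" using N by (simp add: hardy_const_def)
    show "sharp_const N \<le> hardy_const N + d"
    proof -
      have "(1 + d / hardy_const N) * hardy_const N = hardy_const N + d" using h by (simp add: field_simps)
      then show ?thesis using le[of "d / hardy_const N"] d h by simp
    qed
  qed
next
  case False
  then show ?thesis by (simp add: hardy_const_def order_trans[of _ 0])
qed

section \<open>Test functions concentrated near the origin\<close>

lemma num_rep_Suc:
  assumes "k < (Suc K)\<^sup>2"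
  shows "num_rep (Suc N) k = num_rep N k + 2 * (\<Sum>i=1..K. if i\<^sup>2 \<le> k then num_rep N (k - i\<^sup>2) else 0)"
proof -
  define h where "h i = (if i\<^sup>2 \<le> k then num_rep N (k - i\<^sup>2) else 0)" for i :: nat
  have out: "nat \<bar>x\<bar> \<le> K" if "(nat \<bar>x\<bar>)\<^sup>2 \<le> k" for x :: int
    using that assms power_less_imp_less_base[of "nat \<bar>x\<bar>" 2 "Suc K"] by linarith
  have "num_rep (Suc N) k = (\<Sum>x\<in>{- int K..int K}. h (nat \<bar>x\<bar>))"
    unfolding num_rep.simps
    by (rule sum.mono_neutral_cong_left) (auto simp: h_def dest!: out)
  also have "{- int K..int K} = {0} \<union> ({1..int K} \<union> {- int K..-1})" by auto
  also have "(\<Sum>x\<in>\<dots>. h (nat \<bar>x\<bar>)) = h 0 + ((\<Sum>x\<in>{1..int K}. h (nat \<bar>x\<bar>)) + (\<Sum>x\<in>{- int K..-1}. h (nat \<bar>x\<bar>)))"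
    by (subst sum.union_disjoint; simp)+
  also have "(\<Sum>x\<in>{- int K..-1}. h (nat \<bar>x\<bar>)) = (\<Sum>x\<in>{1..int K}. h (nat \<bar>x\<bar>))"
    by (rule sum.reindex_bij_witness[where i = uminus and j = uminus]) auto
  also have "(\<Sum>x\<in>{1..int K}. h (nat \<bar>x\<bar>)) = (\<Sum>i=1..K. h i)"
    by (rule sum.reindex_bij_witness[where i = int and j = nat]) auto
  also have "h 0 = num_rep N k" by (simp add: h_def)
  finally show ?thesis by (simp add: h_def)
qed

text \<open>
  Multiplication by the theta series \<open>1 + 2 q + 2 q\<^sup>4 + \<dots>\<close> on coefficient lists, truncated after \<open>q\<close> to
  the power 35; it turns the representation numbers in dimension \<open>N\<close> into those in dimension \<open>N + 1\<close>.
\<close>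

definition theta_step :: "nat list \<Rightarrow> nat list" where
  "theta_step xs = map (\<lambda>k. xs ! k + 2 * (\<Sum>i\<leftarrow>[1, 2, 3, 4, 5]. if i\<^sup>2 \<le> k then xs ! (k - i\<^sup>2) else 0)) [0..<36]"

lemma theta_step_num_rep: "theta_step (map (num_rep N) [0..<36]) = map (num_rep (Suc N)) [0..<36]"
proof -
  have "map (num_rep N) [0..<36] ! k + 2 * (\<Sum>i\<leftarrow>[1, 2, 3, 4, 5]. if i\<^sup>2 \<le> k then map (num_rep N) [0..<36] ! (k - i\<^sup>2) else 0)
      = num_rep (Suc N) k" if "k < 36" for k
  proof -
    have *: "map (num_rep N) [0..<36] ! i = num_rep N i" if "i \<le> k" for i
      using that \<open>k < 36\<close> by simp
    have "{1..5::nat} = set [1, 2, 3, 4, 5]" by auto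
    then have "(\<Sum>i=1..5. if i\<^sup>2 \<le> k then num_rep N (k - i\<^sup>2) else 0)
        = (\<Sum>i\<leftarrow>[1, 2, 3, 4, 5]. if i\<^sup>2 \<le> k then num_rep N (k - i\<^sup>2) else 0)"
      by (simp add: numeral_eq_Suc del: power_Suc)
    moreover have "k < (Suc 5)\<^sup>2" using that by simp
    ultimately show ?thesis
      using num_rep_Suc[of k 5 N] by (simp only: * diff_le_self order_refl)
  qed
  then show ?thesis unfolding theta_step_def by (simp del: num_rep.simps)
qed

lemma upt_0_36:
  "[0..<36] = [0, 1, 2, 3, 4, 5, 6, 7, 8, 9, 10, 11, 12, 13, 14, 15, 16, 17,
    18, 19, 20, 21, 22, 23, 24, 25, 26, 27, 28, 29, 30, 31, 32, 33, 34, 35]"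
  by (simp add: upt_rec)

lemma upt_0_6: "[0..<6] = [0, 1, 2, 3, 4, 5]"
  by (simp add: upt_rec)

lemma num_rep_0_list: "map (num_rep 0) [0..<36] = 
    [1, 0, 0, 0, 0, 0, 0, 0, 0, 0, 0, 0, 0, 0, 0, 0, 0, 0,
     0, 0, 0, 0, 0, 0, 0, 0, 0, 0, 0, 0, 0, 0, 0, 0, 0, 0]"
  by (simp add: upt_0_36)

lemma num_rep_list_funpow: "map (num_rep N) [0..<36] = (theta_step ^^ N) (map (num_rep 0) [0..<36])"
proof (induction N)
  case (Suc N)
  then show ?case using theta_step_num_rep[of N] by (simp del: num_rep.simps)
qed simp

lemma funpow_8: "(g ^^ 8) x = g (g (g (g (g (g (g (g x)))))))"
  by (simp add: eval_nat_numeral)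

lemma num_rep_8_list: "map (num_rep 8) [0..<36] =
    [1, 16, 112, 448, 1136, 2016, 3136, 5504, 9328, 12112, 14112, 21312, 31808, 35168,
    38528, 56448, 74864, 78624, 84784, 109760, 143136, 154112, 149184, 194688, 261184,
    252016, 246176, 327040, 390784, 390240, 395136, 476672, 599152, 596736, 550368, 693504]"
  (is "_ = ?table")
proof -
  have "map (num_rep 8) [0..<36] = (theta_step ^^ 8) (map (num_rep 0) [0..<36])"
    by (rule num_rep_list_funpow)
  also have "\<dots> = ?table"
    unfolding num_rep_0_list funpow_8 by (simp add: theta_step_def upt_0_36)
  finally show ?thesis .
qed

lemma num_rep_9_list: "map (num_rep 9) [0..<36] =
    [1, 18, 144, 672, 2034, 4320, 7392, 12672, 22608, 34802, 44640, 60768, 93984, 125280,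
    141120, 182400, 262386, 317376, 343536, 421344, 557280, 665280, 703584, 800640,
    1068384, 1256562, 1234080, 1421184, 1851264, 2034720, 2057280, 2338560, 2884176,
    3273792, 3231936, 3487680]"
  (is "_ = ?table")
proof -
  have "map (num_rep 9) [0..<36] = theta_step (map (num_rep 8) [0..<36])"
    using theta_step_num_rep[of 8] by simp
  also have "\<dots> = ?table"
    unfolding num_rep_8_list by (simp add: theta_step_def upt_0_36)
  finally show ?thesis .
qed

text \<open>
  The minimiser of the quotient in dimension 9 among radial functions supported on \<open>\<bar>n\<bar>\<^sup>2 \<le> 35\<close>, scaled by
  10000 and rounded to integers. Its quotient is about \<open>12.244\<close>, just below \<open>49 / 4\<close>; the decay of the
  minimum with the radius is so slow that radial supports much smaller than this do not suffice.
\<close>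

definition profile9 :: "nat list" where
  "profile9 = [0, 10000, 3554, 1520, 794, 482, 323, 228, 166, 124, 96, 75, 60, 48, 40, 33, 27, 23,
    19, 16, 14, 11, 10, 8, 7, 6, 5, 4, 4, 3, 2, 2, 2, 1, 1, 1]"

lemma length_profile9: "length profile9 = 36"
  by (simp add: profile9_def)

lemma sum_atMost_35: "(\<Sum>k\<le>35. h k) = (\<Sum>k\<leftarrow>[0..<36]. (h k :: real))"
proof -
  have "{..35::nat} = set [0..<36]" by auto
  then show ?thesis by (simp only: sum_set_upt_conv_sum_list_nat)
qed

lemma sharp_const_9: "sharp_const 9 < hardy_const 9"
proof -
  define f where "f k = (if k < 36 then real (profile9 ! k) else 0)" for k
  have f: "f k = 0" if "k > 35" for k using that by (simp add: f_def)
  have f0: "f 0 = 0" and f1: "f 1 \<noteq> 0" by (simp_all add: f_def profile9_def)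
  have rep8: "num_rep 8 k = map (num_rep 8) [0..<36] ! k" and rep9: "num_rep 9 k = map (num_rep 9) [0..<36] ! k" if "k < 36" for k
    using that by (simp_all del: num_rep.simps)
  have E: "energy 9 (radial 9 f) = 9 * (\<Sum>s\<leftarrow>[0..<36]. real (map (num_rep 8) [0..<36] ! s) *
           (2 * (\<Sum>x\<leftarrow>[0..<6]. (f (s + (x + 1)\<^sup>2) - f (s + x\<^sup>2))\<^sup>2)))"
  proof -
    have "(\<Sum>x<6. h x) = (\<Sum>x\<leftarrow>[0..<6]. (h x :: real))" for h
      using sum_set_upt_conv_sum_list_nat[of h 0 6] by (simp only: set_upt atLeast0LessThan)
    then show ?thesis
      using energy_radial[of 35 f 6 9] f
      by (simp del: num_rep.simps nth_map upt_Suc add: sum_atMost_35 rep8 cong: map_cong)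
  qed
  have D: "hardy_sum 9 (radial 9 f) = (\<Sum>k\<leftarrow>[0..<36]. real (map (num_rep 9) [0..<36] ! k) * ((f k)\<^sup>2 / real k))"
    using hardy_sum_radial[of 35 f 9] f f0
    by (simp del: num_rep.simps nth_map upt_Suc add: sum_atMost_35 rep9 cong: map_cong)
  have "map f [0..<36] = map real profile9"
    by (rule nth_equalityI) (simp_all add: f_def length_profile9)
  note table_values = this[unfolded upt_0_36 profile9_def, simplified]
  have "energy 9 (radial 9 f) = 52871781996"
    unfolding E num_rep_8_list unfolding upt_0_36 upt_0_6 by (simp add: table_values f flip: numeral_2_eq_2)
  moreover have "hardy_sum 9 (radial 9 f) > 4318271401"
    unfolding D num_rep_9_list unfolding upt_0_36 by (simp add: table_values)
  ultimately have "energy 9 (radial 9 f) < 49 / 4 * hardy_sum 9 (radial 9 f)" by simp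
  moreover have adm: "admissible 9 (radial 9 f)"
    using f f0 f1 by (intro admissible_radial[of 35]) auto
  ultimately have "sharp_const 9 * hardy_sum 9 (radial 9 f) < 49 / 4 * hardy_sum 9 (radial 9 f)"
    using sharp_const_mult_le by (meson le_less_trans)
  then show ?thesis using hardy_sum_pos[OF adm] by (simp add: hardy_const_def power2_eq_square)
qed

lemma num_rep_small: "num_rep N 0 = 1" "num_rep N 1 = 2 * N" "num_rep N 2 = 2 * N * (N - 1)"
proof -
  show r0: "num_rep N 0 = 1" for N
    by (induction N) (simp_all add: num_rep_Suc[of 0 0] del: num_rep.simps(2))
  show r1: "num_rep N 1 = 2 * N" for N
  proof (induction N)
    case (Suc N)
    then show ?case using r0[of N] num_rep_Suc[of 1 1 N] by (simp add: power2_eq_square del: num_rep.simps(2))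
  qed simp
  show "num_rep N 2 = 2 * N * (N - 1)"
  proof (induction N)
    case (Suc N)
    then show ?case using r0 r1 num_rep_Suc[of 2 1 N] by (cases N) (simp_all add: power2_eq_square del: num_rep.simps(2))
  qed simp
qed

text \<open>
  In dimension 10 the minimiser is concentrated near the origin, and three shells with
  heights \<open>20, 5, 1\<close> already give the quotient \<open>16840 / 1057 < 16\<close>.
\<close>

lemma sharp_const_10: "sharp_const 10 < hardy_const 10"
proof -
  define f :: "nat \<Rightarrow> real" where "f k = (if k = 1 then 20 else if k = 2 then 5 else if k = 3 then 1 else 0)" for k
  have f: "f k = 0" if "k > 3" for k using that by (simp add: f_def)
  have f0: "f 0 = 0" and f1: "f 1 \<noteq> 0" by (simp_all add: f_def)
  have "num_rep 9 3 = map (num_rep 9) [0..<36] ! 3" by (simp del: num_rep.simps)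
  then have r9: "num_rep 9 3 = 672" unfolding num_rep_9_list by simp
  then have r10: "num_rep 10 3 = 960"
    using num_rep_Suc[of 3 1 9] num_rep_small(3)[of 9] by (simp add: power2_eq_square del: num_rep.simps)
  have E: "energy 10 (radial 10 f) = 168400"
    using energy_radial[of 3 f 2 10] f r9 num_rep_small[of 9]
    by (simp del: num_rep.simps add: f_def atMost_Suc lessThan_Suc numeral_2_eq_2 numeral_3_eq_3)
  have D: "hardy_sum 10 (radial 10 f) = 10570"
    using hardy_sum_radial[of 3 f 10] f f0 r10 num_rep_small[of 10]
    by (simp del: num_rep.simps add: f_def atMost_Suc numeral_2_eq_2 numeral_3_eq_3)
  have adm: "admissible 10 (radial 10 f)"
    using f f0 f1 by (intro admissible_radial[of 3]) auto
  show ?thesis using sharp_const_mult_le[OF adm] by (simp add: E D hardy_const_def)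
qed

text \<open>
  The difference \<open>3 N - hardy_const N\<close> decreases from \<open>51 / 4\<close> at \<open>N = 11\<close>, whereas the square root
  increases and is already above 14 there.
\<close>

lemma Lambda2_bounds:
  assumes "N \<ge> 11"
  shows "Lambda2 N < hardy_const N" "Lambda2 N < 2 * real N"
proof -
  have N: "real N \<ge> 11" using assms by simp
  show "Lambda2 N < 2 * real N"
  proof -
    have "real N < sqrt ((real N)\<^sup>2 + 8 * real N - 8)" by (rule real_less_rsqrt) (use N in simp)
    then show ?thesis by (simp add: Lambda2_def)
  qed
  have "14\<^sup>2 \<le> (real N)\<^sup>2 + 8 * real N - 8"
    using N mult_mono[OF N N] by (simp add: power2_eq_square)
  then have "14 \<le> sqrt ((real N)\<^sup>2 + 8 * real N - 8)" by (rule real_le_rsqrt)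
  moreover have "3 * real N - hardy_const N < 14"
  proof -
    have "3 * real N - hardy_const N = 51 / 4 - (real N - 11) * (real N - 5) / 4"
      by (simp add: hardy_const_def power2_eq_square field_simps)
    moreover have "(real N - 11) * (real N - 5) \<ge> 0" using N by simp
    ultimately show ?thesis by linarith
  qed
  ultimately show "Lambda2 N < hardy_const N" by (simp add: Lambda2_def)
qed

text \<open>
  On functions with value \<open>a\<close> on the shell \<open>\<bar>n\<bar>\<^sup>2 = 1\<close>, value \<open>b\<close> on the shell \<open>\<bar>n\<bar>\<^sup>2 = 2\<close> and 0 elsewhere
  the quotient is one of two quadratic forms in \<open>(a, b)\<close>. Its minimum is the smaller root of a quadratic
  equation, which is \<open>Lambda2 N\<close>, and it is attained at the \<open>a\<close> and \<open>b\<close> chosen below.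
\<close>

lemma sharp_const_le_Lambda2:
  assumes N: "N \<ge> 2"
  shows "sharp_const N \<le> Lambda2 N"
proof -
  define r where "r = sqrt ((real N)\<^sup>2 + 8 * real N - 8)"
  have pos: "(real N)\<^sup>2 + 8 * real N - 8 \<ge> 0" using N zero_le_power2[of "real N"] by linarith
  then have r2: "r\<^sup>2 = (real N)\<^sup>2 + 8 * real N - 8" by (simp add: r_def)
  \<comment> \<open>The eigenvector equation \<open>(2 N - Lambda2 N) a = 2 (N - 1) b\<close> with denominators cleared.\<close>
  define a b where "a = 2 * (real N - 1)" and "b = r - real N"
  define f where "f k = (if k = 1 then a else if k = 2 then b else 0)" for k :: nat
  have f: "f k = 0" if "k > 2" for k using that by (simp add: f_def)
  have f0: "f 0 = 0" and f1: "f 1 \<noteq> 0" using N by (simp_all add: f_def a_def)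
  have E: "energy N (radial N f) = 4 * real N * (real N * a\<^sup>2 + real N * (real N - 1) * b\<^sup>2 - 2 * (real N - 1) * a * b)"
  proof -
    have "num_rep (N - 1) (Suc 0) = 2 * (N - 1)" "num_rep (N - 1) (Suc (Suc 0)) = 2 * (N - 1) * (N - 2)" "num_rep (N - 1) 0 = 1"
      using num_rep_small[of "N - 1"] by (simp_all add: numeral_2_eq_2)
    moreover have "real (N - 1) = real N - 1" "real (N - 2) = real N - 2" using N by auto
    ultimately show ?thesis
    using energy_radial[of 2 f 2 N] f 
    by (simp add: f_def atMost_Suc lessThan_Suc numeral_2_eq_2) (simp add: power2_eq_square algebra_simps)
  qed
  have D: "hardy_sum N (radial N f) = 2 * real N * a\<^sup>2 + real N * (real N - 1) * b\<^sup>2"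
  proof -
    have "num_rep N (Suc 0) = 2 * N" "num_rep N (Suc (Suc 0)) = 2 * N * (N - 1)"
      using num_rep_small[of N] by (simp_all add: numeral_2_eq_2)
    moreover have "real (N - 1) = real N - 1" using N by auto
    ultimately show ?thesis
      using hardy_sum_radial[of 2 f N] f f0
      by (simp add: f_def atMost_Suc numeral_2_eq_2)
  qed
  have adm: "admissible N (radial N f)"
    using f f0 f1 N by (intro admissible_radial[of 2]) auto
  have "energy N (radial N f) = Lambda2 N * hardy_sum N (radial N f)"
    unfolding E D Lambda2_def r_def[symmetric] a_def b_def using r2 by algebra
  then have "sharp_const N * hardy_sum N (radial N f) \<le> Lambda2 N * hardy_sum N (radial N f)"
    using sharp_const_mult_le[OF adm] by simp
  then show ?thesis using hardy_sum_pos[OF adm] by simp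
qed

section \<open>The sharp constant\<close>

lemma hardy_const_le_sharp_const:
  assumes "N \<in> {3, 4}"
  shows "hardy_const N \<le> sharp_const N"
  unfolding sharp_const_def
proof (rule cInf_greatest)
  define f :: "nat \<Rightarrow> real" where "f k = (if k = 1 then 1 else 0)" for k
  have "admissible N (radial N f)"
    by (rule admissible_radial[of 1]) (use assms in \<open>auto simp: f_def\<close>)
  then show "{energy N u / hardy_sum N u |u. admissible N u} \<noteq> {}" by blast
next
  fix q assume "q \<in> {energy N u / hardy_sum N u |u. admissible N u}"
  then show "hardy_const N \<le> q"
    using hardy_inequality[OF assms] hardy_sum_pos by (auto simp: le_divide_eq)
qed

theorem theorem1p1:
  "(\<forall>N\<ge>3. sharp_const N \<le> hardy_const N)
   \<and> (sharp_const 3 = hardy_const 3 \<and> hardy_const 3 = 1 / 4)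
   \<and> (sharp_const 4 = hardy_const 4 \<and> hardy_const 4 = 1)
   \<and> (\<forall>N\<in>{9, 10}. sharp_const N < hardy_const N)
   \<and> (\<forall>N\<ge>11. sharp_const N \<le> Lambda2 N \<and> Lambda2 N < min (hardy_const N) (2 * real N))"
proof (intro conjI)
  show "\<forall>N\<ge>3. sharp_const N \<le> hardy_const N"
    using sharp_const_le_hardy_const by blast
  show "sharp_const 3 = hardy_const 3" "sharp_const 4 = hardy_const 4"
    by (rule antisym; simp add: sharp_const_le_hardy_const hardy_const_le_sharp_const)+
  show "hardy_const 3 = 1 / 4" "hardy_const 4 = 1"
    by (simp_all add: hardy_const_def)
  show "\<forall>N\<in>{9, 10}. sharp_const N < hardy_const N"
    using sharp_const_9 sharp_const_10 by blast
  show "\<forall>N\<ge>11. sharp_const N \<le> Lambda2 N \<and> Lambda2 N < min (hardy_const N) (2 * real N)"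
    using sharp_const_le_Lambda2 Lambda2_bounds by simp
qed

end
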